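(* Let $E$ be a $D$-convex rearrangement invariant space on $[0,1]$. Then both of the following hold. (i) The natural embedding $E \subset L_1([0,1])$ is not strictly singular if and only if $G$ embeds into $E$ continuously (i.e. $G\subset E$ and the inclusion map $G \to E$ is bounded). (ii) There is a constant $c>0$ (depending only on $E$) such that for every $n \ge 1$ and all $x_1,\dots,x_n \in L_1([0,1])$ there exist signs $\epsilon_1,\dots,\epsilon_n \in \{-1,1\}$ such that $$ \left\|\sum_{i=1}^n \epsilon_i x_i\right\|_{E} \ge c^{-1} \left\|\sum_{i=1}^n \|x_i\|_{L_1}\, r_i\right\|_E .$$
   Context: All function spaces consist of (equivalence classes modulo a.e. equality of) real measurable functions on $[0,1]$ with Lebesgue measure. For a measurable function $x$, $x^*$ denotes the non-increasing rearrangement of $|x|$. A rearrangement invariant (r.i.) space $E$ on $[0,1]$ (in the sense of Lindenstrauss–Tzafriri) is a Banach space of such functions with the following properties. If $y\in E$ and $|x|\le |y|$ a.e., then $x\in E$ and $\|x\|_E\le\|y\|_E$. If $y\in E$ and $x^*=y^*$, then $x\in E$ and $\|x\|_E=\|y\|_E$. One has $L_\infty([0,1])\subset E\subset L_1([0,1])$ with both inclusions of norm one. Finally, let $E'$ be the space of measurable $y$ with $\|y\|_{E'}=\sup\{\int_0^1 xy\,dt : \|x\|_E\le 1\}<\infty$, and let $E''=(E')'$. Then $\|x\|_E=\|x\|_{E''}$ for $x\in E$, and $E$ is either equal to $E''$ or equal to the closure of the simple functions in $E''$. By convention $\|x\|_E=\infty$ if $x\in L_1([0,1])\setminus E$. A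 bounded linear map between normed spaces is strictly singular if there is no infinite-dimensional subspace of the domain on which the map is an isomorphism onto its image. An Orlicz function is a function $\Phi:\mathbb{R}\to[0,\infty)$ that is convex, even and satisfies $\Phi(0)=0$. The Orlicz space $L_\Phi$ consists of all $x$ for which $\|x\|_\Phi=\inf\{\lambda>0:\int_0^1\Phi(x(t)/\lambda)\,dt\le 1\}$ is finite. $G$ denotes the closure of the simple functions in the Orlicz space $L_\Phi$ with $\Phi(x)=e^{x^2}-1$. An r.i. space $E$ is $D$-convex if there are a family of Orlicz functions $(\Phi_\alpha)$ and a constant $c>0$ such that $c^{-1}\|x\|_E\le\sup_\alpha\|x\|_{\Phi_\alpha}\le\|x\|_E$ for all $x\in E$. The Rademacher functions are $r_n(t)=\operatorname{sign}(\sin(2^n\pi t))$, $t\in[0,1]$, $n\ge1$. *)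

theory Defs
  imports "HOL-Probability.Essential_Supremum" "HOL-Analysis.Analysis"
begin

text \<open>
  Elements of function spaces are represented by Lebesgue measurable functions on $[0,1]$ that
  are identified when they agree almost everywhere; values outside $[0,1]$ are irrelevant.
  A normed function space is given by an extended norm \<open>N\<close>: the space itself is
  \<open>carrier_of N\<close>, and a measurable function outside of the space has norm \<open>\<infinity>\<close>.
  The value of \<open>N\<close> at non-measurable functions is irrelevant.
\<close>

type_synonym ext_norm = "(real \<Rightarrow> real) \<Rightarrow> ennreal"

abbreviation unit_leb :: "real measure" where
  "unit_leb \<equiv> lebesgue_on {0..1}"

definition carrier_of :: "ext_norm \<Rightarrow> (real \<Rightarrow> real) set" where
  "carrier_of N = {x \<in> borel_measurable unit_leb. N x < \<infinity>}"

text \<open>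
  In a normed space of a.e. equivalence classes the norm vanishes exactly on the class of 0;
  with the triangle inequality this forces a.e. equal functions to have equal norms.
\<close>

definition normed_function_space :: "ext_norm \<Rightarrow> bool" where
  "normed_function_space N \<longleftrightarrow>
     (\<forall>x \<in> borel_measurable unit_leb. N x = 0 \<longleftrightarrow> (AE t in unit_leb. x t = 0)) \<and>
     (\<forall>x \<in> carrier_of N. \<forall>a::real. N (\<lambda>t. a * x t) = ennreal \<bar>a\<bar> * N x) \<and>
     (\<forall>x \<in> carrier_of N. \<forall>y \<in> carrier_of N. N (\<lambda>t. x t + y t) \<le> N x + N y)"

definition banach_function_space :: "ext_norm \<Rightarrow> bool" where
  "banach_function_space N \<longleftrightarrow> normed_function_space N \<and>
     (\<forall>u :: nat \<Rightarrow> real \<Rightarrow> real.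
        (\<forall>n. u n \<in> carrier_of N) \<and>
        (\<forall>e>0. \<exists>K. \<forall>m\<ge>K. \<forall>n\<ge>K. N (\<lambda>t. u m t - u n t) < ennreal e) \<longrightarrow>
        (\<exists>x \<in> carrier_of N. (\<lambda>n. N (\<lambda>t. u n t - x t)) \<longlonglongrightarrow> 0))"

definition L1_norm :: ext_norm where
  "L1_norm x = (\<integral>\<^sup>+ t. ennreal \<bar>x t\<bar> \<partial>unit_leb)"

definition Linf_norm :: ext_norm where
  "Linf_norm x = esssup unit_leb (\<lambda>t. ennreal \<bar>x t\<bar>)"

text \<open>The operator norm of the inclusion map, meaningful if \<open>carrier_of N \<subseteq> carrier_of N'\<close>.\<close>

definition inclusion_norm :: "ext_norm \<Rightarrow> ext_norm \<Rightarrow> ennreal" where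
  "inclusion_norm N N' = (SUP x \<in> {x \<in> carrier_of N. N x \<le> 1}. N' x)"

definition continuously_embeds :: "ext_norm \<Rightarrow> ext_norm \<Rightarrow> bool" where
  "continuously_embeds N N' \<longleftrightarrow> carrier_of N \<subseteq> carrier_of N' \<and>
     (\<exists>C::real. \<forall>x \<in> carrier_of N. N' x \<le> ennreal C * N x)"

text \<open>
  Only arguments \<open>t > 0\<close> are used: there the set below is nonempty,
  whereas at \<open>t = 0\<close> it is empty for unbounded \<open>x\<close>.
\<close>

definition rearrangement :: "(real \<Rightarrow> real) \<Rightarrow> real \<Rightarrow> real" where
  "rearrangement x t = Inf {s. 0 \<le> s \<and> measure unit_leb {u \<in> {0..1}. s < \<bar>x u\<bar>} \<le> t}"

definition same_rearrangement :: "(real \<Rightarrow> real) \<Rightarrow> (real \<Rightarrow> real) \<Rightarrow> bool" where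
  "same_rearrangement x y \<longleftrightarrow> (\<forall>t \<in> {0<..1}. rearrangement x t = rearrangement y t)"

text \<open>
  The norm of the associate space $E'$. Negative integrals are truncated to 0, which does not
  affect the supremum since \<open>x = 0\<close> is admissible; likewise an \<open>x\<close> for which \<open>x * y\<close> is not
  integrable contributes 0. For an ideal space the supremum is still \<open>\<infinity>\<close> if there is such
  an \<open>x\<close>, because of the truncations of \<open>\<bar>x\<bar> * sgn y\<close>.
\<close>

definition assoc_norm :: "ext_norm \<Rightarrow> ext_norm" where
  "assoc_norm N y = (SUP x \<in> {x \<in> carrier_of N. N x \<le> 1}. ennreal (LINT t|unit_leb. x t * y t))"

definition simple_closure :: "ext_norm \<Rightarrow> (real \<Rightarrow> real) set" where
  "simple_closure N = {x \<in> carrier_of N.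
     \<forall>e>0. \<exists>s. simple_function unit_leb s \<and> N (\<lambda>t. x t - s t) < ennreal e}"

definition ri_space :: "ext_norm \<Rightarrow> bool" where
  "ri_space N \<longleftrightarrow> banach_function_space N \<and>
     (\<forall>y \<in> carrier_of N. \<forall>x \<in> borel_measurable unit_leb.
        (AE t in unit_leb. \<bar>x t\<bar> \<le> \<bar>y t\<bar>) \<longrightarrow> x \<in> carrier_of N \<and> N x \<le> N y) \<and>
     (\<forall>y \<in> carrier_of N. \<forall>x \<in> borel_measurable unit_leb.
        same_rearrangement x y \<longrightarrow> x \<in> carrier_of N \<and> N x = N y) \<and>
     carrier_of Linf_norm \<subseteq> carrier_of N \<and> inclusion_norm Linf_norm N = 1 \<and>
     carrier_of N \<subseteq> carrier_of L1_norm \<and> inclusion_norm N L1_norm = 1 \<and>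
     (\<forall>x \<in> carrier_of N. N x = assoc_norm (assoc_norm N) x) \<and>
     (carrier_of N = carrier_of (assoc_norm (assoc_norm N)) \<or>
      carrier_of N = simple_closure (assoc_norm (assoc_norm N)))"

definition orlicz_function :: "(real \<Rightarrow> real) \<Rightarrow> bool" where
  "orlicz_function \<Phi> \<longleftrightarrow>
     (\<forall>x. 0 \<le> \<Phi> x) \<and> convex_on UNIV \<Phi> \<and> (\<forall>x. \<Phi> (- x) = \<Phi> x) \<and> \<Phi> 0 = 0"

definition orlicz_norm :: "(real \<Rightarrow> real) \<Rightarrow> ext_norm" where
  "orlicz_norm \<Phi> x =
     Inf {ennreal l | l. 0 < l \<and> (\<integral>\<^sup>+ t. ennreal (\<Phi> (x t / l)) \<partial>unit_leb) \<le> 1}"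

definition G_norm :: ext_norm where
  "G_norm x =
     (if x \<in> simple_closure (orlicz_norm (\<lambda>u. exp (u\<^sup>2) - 1))
      then orlicz_norm (\<lambda>u. exp (u\<^sup>2) - 1) x else \<infinity>)"

definition D_convex :: "ext_norm \<Rightarrow> bool" where
  "D_convex N \<longleftrightarrow>
     (\<exists>F. (\<forall>\<Phi>\<in>F. orlicz_function \<Phi>) \<and>
        (\<exists>c::real. c > 0 \<and>
           (\<forall>x \<in> carrier_of N.
              ennreal (inverse c) * N x \<le> (SUP \<Phi>\<in>F. orlicz_norm \<Phi> x) \<and>
              (SUP \<Phi>\<in>F. orlicz_norm \<Phi> x) \<le> N x)))"

definition function_subspace :: "(real \<Rightarrow> real) set \<Rightarrow> bool" where
  "function_subspace V \<longleftrightarrow> (\<lambda>t. 0) \<in> V \<and>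
     (\<forall>x\<in>V. \<forall>y\<in>V. (\<lambda>t. x t + y t) \<in> V) \<and> (\<forall>a::real. \<forall>x\<in>V. (\<lambda>t. a * x t) \<in> V)"

text \<open>Infinite-dimensional modulo a.e. equality.\<close>

definition ae_infinite_dimensional :: "(real \<Rightarrow> real) set \<Rightarrow> bool" where
  "ae_infinite_dimensional V \<longleftrightarrow>
     \<not> (\<exists>B. finite B \<and> B \<subseteq> V \<and>
           (\<forall>x\<in>V. \<exists>a :: (real \<Rightarrow> real) \<Rightarrow> real. AE t in unit_leb. x t = (\<Sum>b\<in>B. a b * b t)))"

definition iso_onto_image_on ::
  "ext_norm \<Rightarrow> ext_norm \<Rightarrow> ((real \<Rightarrow> real) \<Rightarrow> (real \<Rightarrow> real)) \<Rightarrow> (real \<Rightarrow> real) set \<Rightarrow> bool" where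
  "iso_onto_image_on N N' T V \<longleftrightarrow>
     (\<exists>a b :: real. 0 < a \<and> 0 < b \<and>
        (\<forall>x\<in>V. ennreal a * N x \<le> N' (T x) \<and> N' (T x) \<le> ennreal b * N x))"

text \<open>Intended for bounded linear maps \<open>T\<close> from \<open>carrier_of N\<close> to \<open>carrier_of N'\<close>.\<close>

definition strictly_singular ::
  "ext_norm \<Rightarrow> ext_norm \<Rightarrow> ((real \<Rightarrow> real) \<Rightarrow> (real \<Rightarrow> real)) \<Rightarrow> bool" where
  "strictly_singular N N' T \<longleftrightarrow>
     \<not> (\<exists>V. V \<subseteq> carrier_of N \<and> function_subspace V \<and> ae_infinite_dimensional V \<and>
           iso_onto_image_on N N' T V)"

definition rademacher :: "nat \<Rightarrow> real \<Rightarrow> real" where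
  "rademacher n t = sgn (sin (2 ^ n * pi * t))"

end

theory Submission
  imports Defs "HOL-Probability.Hoeffding"
begin

text \<open>
  Part (ii): for an Orlicz function \<open>\<Phi>\<close>, average \<open>\<integral> \<Phi> (\<Sum> \<epsilon>\<^sub>i x\<^sub>i)\<close> over all signs. Replacing \<open>x\<^sub>i\<close> by
  \<open>\<bar>x\<^sub>i\<bar>\<close> does not change the average, and Jensen's inequality bounds it below by
  \<open>\<integral> \<Phi> (\<Sum> \<parallel>x\<^sub>i\<parallel>\<^sub>1 r\<^sub>i)\<close>; then take suprema over the family given by $D$-convexity.

  Part (i), from right to left: the span of the Rademacher functions is Hilbertian in both
  $G$ and $L_1$ (Khinchine).

  Part (i), from left to right: let $V$ be an infinite-dimensional space on which the norms of $E$
  and $L_1$ are equivalent. By Lewis' change of density, every $n$-dimensional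
  subspace of $V$ contains \<open>y\<^sub>1, \<dots>, y\<^sub>n\<close> with \<open>\<parallel>\<Sum> u\<^sub>i y\<^sub>i\<parallel>\<^sub>1 \<le> \<bar>u\<bar>\<close> for all \<open>u\<close> and
  \<open>\<integral> (\<Sum> y\<^sub>i\<^sup>2)\<^sup>1\<^sup>/\<^sup>2 \<ge> c \<surd>n\<close>. Summing \<open>\<integral> \<Phi> (\<Sum> u\<^sub>i y\<^sub>i)\<close> over exponentially many \<open>u\<close> forming a norming
  subset of the Euclidean ball, and applying Jensen's inequality, yields \<open>\<Phi> (c \<surd>n) \<le> 48\<^sup>n\<close> for
  all $n$ and every \<open>\<Phi>\<close> in the family. Hence all these Orlicz norms are dominated by the one of
  $e^{x^2} - 1$ on simple functions, and completeness of $E$ extends this to $G$.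
\<close>

section \<open>Orlicz norms\<close>

text \<open>Inequalities between norms can be neither averaged nor summed, but bounds of the form
  \<open>\<integral> \<Phi> (x / l) \<le> 1\<close> can. This is what D-convexity provides: each
  argument is run for a single \<open>\<Phi>\<close>, with constants that do not depend on
  \<open>\<Phi>\<close>, and the supremum over the family is taken last. The exponent 2 in the
  Orlicz function of G comes from a balance. A normalized n-dimensional system in L_1 can be spread
  out so that its Euclidean length is of order \<open>sqrt n\<close> on average, while exponentially
  many directions suffice to detect this length at every point. So \<open>\<Phi>\<close> at height
  \<open>s\<close> of order \<open>sqrt n\<close> is at most exponential in \<open>n\<close>, that
  is, in \<open>s^2\<close>; convexity of \<open>\<Phi>\<close> then turns the remaining constants
  into a rescaling of the argument. The comparison is made on simple functions first because the
  lower estimate in D-convexity is available only for members of E, and an element of G is not known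
  to be one until the limit has been taken.\<close>

lemma orlicz_scale_le:
  assumes "orlicz_function \<Phi>" "0 \<le> t" "t \<le> 1"
  shows "\<Phi> (t * x) \<le> t * \<Phi> x"
proof -
  have c: "convex_on UNIV \<Phi>" and z: "\<Phi> 0 = 0"
    using assms by (auto simp: orlicz_function_def)
  show ?thesis
    using convex_onD[OF c assms(2,3), of 0 x] z by simp
qed

lemma orlicz_mono:
  assumes "orlicz_function \<Phi>" "\<bar>x\<bar> \<le> \<bar>y\<bar>"
  shows "\<Phi> x \<le> \<Phi> y"
proof (cases "y = 0")
  case True then show ?thesis using assms by simp
next
  case False
  have ev: "\<Phi> \<bar>z\<bar> = \<Phi> z" for z
    using assms(1) by (auto simp: orlicz_function_def abs_if)
  have nn: "0 \<le> \<Phi> y" using assms(1) by (auto simp: orlicz_function_def)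
  let ?t = "\<bar>x\<bar> / \<bar>y\<bar>"
  have t: "0 \<le> ?t" "?t \<le> 1" using assms(2) False by (auto simp: divide_simps)
  have "\<Phi> x = \<Phi> (?t * \<bar>y\<bar>)" using False ev by simp
  also have "\<dots> \<le> ?t * \<Phi> \<bar>y\<bar>" by (rule orlicz_scale_le[OF assms(1) t])
  also have "\<dots> \<le> 1 * \<Phi> y" unfolding ev using t nn by (intro mult_right_mono) auto
  finally show ?thesis by simp
qed

lemma orlicz_measurable:
  assumes "orlicz_function \<Phi>"
  shows "\<Phi> \<in> borel_measurable borel"
  using assms unfolding orlicz_function_def
  by (intro borel_measurable_continuous_onI convex_on_continuous) auto

lemma prob_space_unit_leb: "prob_space unit_leb"
  by (rule prob_spaceI) (simp add: emeasure_restrict_space space_restrict_space)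

interpretation unit_leb: prob_space unit_leb
  by (rule prob_space_unit_leb)

lemma emeasure_unit_leb [simp]: "emeasure unit_leb {0..1} = 1"
  using unit_leb.emeasure_space_1 by simp

lemma borel_imp_unit_leb:
  "f \<in> borel_measurable borel \<Longrightarrow> f \<in> borel_measurable unit_leb"
  by (intro measurable_restrict_space1 measurable_completion) simp

lemma orlicz_norm_le:
  assumes "0 < l" "(\<integral>\<^sup>+ t. ennreal (\<Phi> (x t / l)) \<partial>unit_leb) \<le> 1"
  shows "orlicz_norm \<Phi> x \<le> ennreal l"
  unfolding orlicz_norm_def using assms by (intro Inf_lower) auto

text \<open>The strict inequality leaves room for an admissible scale below \<open>l\<close>;
  monotonicity of \<open>\<Phi>\<close> passes from that scale to \<open>l\<close>.\<close>

lemma orlicz_integral_le_1: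
  assumes \<Phi>: "orlicz_function \<Phi>" and "orlicz_norm \<Phi> x < ennreal l"
  shows "(\<integral>\<^sup>+ t. ennreal (\<Phi> (x t / l)) \<partial>unit_leb) \<le> 1"
proof -
  obtain k where k: "0 < k" "ennreal k < ennreal l"
      "(\<integral>\<^sup>+ t. ennreal (\<Phi> (x t / k)) \<partial>unit_leb) \<le> 1"
    using assms(2) unfolding orlicz_norm_def Inf_less_iff by auto
  have kl: "k < l" using k(1,2) by (simp add: ennreal_less_iff)
  have "\<Phi> (x t / l) \<le> \<Phi> (x t / k)" for t
    using k(1) kl by (intro orlicz_mono[OF \<Phi>]) (simp add: abs_divide frac_le)
  then have "(\<integral>\<^sup>+ t. ennreal (\<Phi> (x t / l)) \<partial>unit_leb) \<le> (\<integral>\<^sup>+ t. ennreal (\<Phi> (x t / k)) \<partial>unit_leb)"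
    by (intro nn_integral_mono ennreal_leI) auto
  with k(3) show ?thesis by simp
qed

lemma orlicz_norm_triangle:
  assumes \<Phi>: "orlicz_function \<Phi>"
    and x: "x \<in> borel_measurable unit_leb" and y: "y \<in> borel_measurable unit_leb"
  shows "orlicz_norm \<Phi> (\<lambda>t. x t + y t) \<le> orlicz_norm \<Phi> x + orlicz_norm \<Phi> y"
proof (rule ennreal_le_epsilon)
  fix e :: real
  assume e: "0 < e" and fin: "orlicz_norm \<Phi> x + orlicz_norm \<Phi> y < top"
  obtain p q where p: "orlicz_norm \<Phi> x = ennreal p" "0 \<le> p" and q: "orlicz_norm \<Phi> y = ennreal q" "0 \<le> q"
    using fin by (cases "orlicz_norm \<Phi> x"; cases "orlicz_norm \<Phi> y") auto
  \<comment> \<open>The margin \<open>e/2\<close> makes both scales positive and strictly larger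
    than the norms. The sum is then a convex combination of the two normalized functions with
    weights \<open>k/(k+l)\<close> and \<open>l/(k+l)\<close>.\<close>
  define k l where "k = p + e/2" and "l = q + e/2"
  have kl: "0 < k" "0 < l" using p q e by (auto simp: k_def l_def)
  have ix: "(\<integral>\<^sup>+ t. ennreal (\<Phi> (x t / k)) \<partial>unit_leb) \<le> 1"
    using p q e by (intro orlicz_integral_le_1[OF \<Phi>]) (simp add: k_def ennreal_less_iff)
  have iy: "(\<integral>\<^sup>+ t. ennreal (\<Phi> (y t / l)) \<partial>unit_leb) \<le> 1"
    using p q e by (intro orlicz_integral_le_1[OF \<Phi>]) (simp add: l_def ennreal_less_iff)
  have c: "convex_on UNIV \<Phi>" and nn: "\<And>u. 0 \<le> \<Phi> u"
    using \<Phi> by (auto simp: orlicz_function_def)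
  note [measurable] = orlicz_measurable[OF \<Phi>] x y
  have pt: "\<Phi> ((x t + y t) / (k + l)) \<le> k/(k+l) * \<Phi> (x t / k) + l/(k+l) * \<Phi> (y t / l)" for t
  proof -
    have "\<Phi> ((1 - l/(k+l)) *\<^sub>R (x t / k) + (l/(k+l)) *\<^sub>R (y t / l))
        \<le> (1 - l/(k+l)) * \<Phi> (x t / k) + l/(k+l) * \<Phi> (y t / l)"
      using kl by (intro convex_onD[OF c]) auto
    moreover have "1 - l/(k+l) = k/(k+l)" using kl by (simp add: field_simps)
    moreover have "(k/(k+l)) * (x t / k) + (l/(k+l)) * (y t / l) = (x t + y t)/(k+l)"
      using kl by (simp add: add_divide_distrib)
    ultimately show ?thesis by simp
  qed
  have "(\<integral>\<^sup>+ t. ennreal (\<Phi> ((x t + y t) / (k + l))) \<partial>unit_leb)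
     \<le> (\<integral>\<^sup>+ t. ennreal (k/(k+l)) * ennreal (\<Phi> (x t / k)) + ennreal (l/(k+l)) * ennreal (\<Phi> (y t / l)) \<partial>unit_leb)"
    using pt kl nn by (intro nn_integral_mono) (simp flip: ennreal_mult ennreal_plus)
  also have "\<dots> = ennreal (k/(k+l)) * (\<integral>\<^sup>+ t. ennreal (\<Phi> (x t / k)) \<partial>unit_leb)
      + ennreal (l/(k+l)) * (\<integral>\<^sup>+ t. ennreal (\<Phi> (y t / l)) \<partial>unit_leb)"
    by (subst nn_integral_add) (auto simp: nn_integral_cmult)
  also have "\<dots> \<le> ennreal (k/(k+l)) * 1 + ennreal (l/(k+l)) * 1"
    using ix iy by (intro add_mono mult_left_mono) auto
  also have "\<dots> = 1" using kl by (simp flip: ennreal_plus add: add_divide_distrib[symmetric])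
  finally have "orlicz_norm \<Phi> (\<lambda>t. x t + y t) \<le> ennreal (k + l)"
    using kl by (intro orlicz_norm_le) auto
  also have "\<dots> = orlicz_norm \<Phi> x + orlicz_norm \<Phi> y + ennreal e"
    using p q e by (simp add: k_def l_def flip: ennreal_plus)
  finally show "orlicz_norm \<Phi> (\<lambda>t. x t + y t) \<le> orlicz_norm \<Phi> x + orlicz_norm \<Phi> y + ennreal e" .
qed

lemma orlicz_norm_uminus:
  assumes "orlicz_function \<Phi>"
  shows "orlicz_norm \<Phi> (\<lambda>t. - x t) = orlicz_norm \<Phi> x"
  using assms by (simp add: orlicz_norm_def orlicz_function_def)

lemma orlicz_norm_zero:
  assumes "orlicz_function \<Phi>"
  shows "orlicz_norm \<Phi> (\<lambda>t. 0) = 0"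
proof -
  have "orlicz_norm \<Phi> (\<lambda>t. 0) \<le> ennreal e" if "0 < e" for e
    using that assms by (intro orlicz_norm_le) (auto simp: orlicz_function_def)
  then have "orlicz_norm \<Phi> (\<lambda>t. 0) \<le> 0"
    by (metis ennreal_le_epsilon[of 0 "orlicz_norm \<Phi> (\<lambda>t. 0)"] add_0)
  then show ?thesis by simp
qed

section \<open>The Orlicz function of G, and comparison with L_1\<close>

abbreviation exp_square :: "real \<Rightarrow> real" where
  "exp_square \<equiv> \<lambda>u. exp (u\<^sup>2) - 1"

lemma orlicz_function_exp_square: "orlicz_function exp_square"
proof -
  have sq: "convex_on UNIV (\<lambda>u::real. u\<^sup>2)" by (rule convex_power2)
  have "convex_on UNIV exp_square"
  proof (rule convex_onI)
    fix t x y :: real assume t: "0 < t" "t < 1"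
    have "((1 - t) *\<^sub>R x + t *\<^sub>R y)\<^sup>2 \<le> (1 - t) * x\<^sup>2 + t * y\<^sup>2"
      using convex_onD[OF sq, of t x y] t by simp
    then have "exp (((1 - t) *\<^sub>R x + t *\<^sub>R y)\<^sup>2) \<le> exp ((1 - t) * x\<^sup>2 + t * y\<^sup>2)" by simp
    also have "\<dots> \<le> (1 - t) * exp (x\<^sup>2) + t * exp (y\<^sup>2)"
      using convex_onD[OF exp_convex, of t "x\<^sup>2" "y\<^sup>2"] t by simp
    finally show "exp (((1 - t) *\<^sub>R x + t *\<^sub>R y)\<^sup>2) - 1
        \<le> (1 - t) * (exp (x\<^sup>2) - 1) + t * (exp (y\<^sup>2) - 1)"
      by (simp add: algebra_simps)
  qed simp
  then show ?thesis by (simp add: orlicz_function_def)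
qed

lemma le_orlicz_normI:
  assumes "\<And>l. 0 < l \<Longrightarrow> (\<integral>\<^sup>+ t. ennreal (\<Phi> (x t / l)) \<partial>unit_leb) \<le> 1 \<Longrightarrow> z \<le> ennreal (C * l)"
    and C: "0 < C"
  shows "z \<le> ennreal C * orlicz_norm \<Phi> x"
proof -
  have "z / ennreal C \<le> orlicz_norm \<Phi> x"
    unfolding orlicz_norm_def
  proof (rule Inf_greatest)
    fix y assume "y \<in> {ennreal l |l. 0 < l \<and> (\<integral>\<^sup>+ t. ennreal (\<Phi> (x t / l)) \<partial>unit_leb) \<le> 1}"
    then obtain l where l: "y = ennreal l" "0 < l" "(\<integral>\<^sup>+ t. ennreal (\<Phi> (x t / l)) \<partial>unit_leb) \<le> 1"
      by auto
    have "z / ennreal C \<le> ennreal (C * l) / ennreal C" by (intro divide_right_mono_ennreal assms l)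
    also have "\<dots> = y" using l C by (simp add: divide_ennreal)
    finally show "z / ennreal C \<le> y" .
  qed
  then have "ennreal C * (z / ennreal C) \<le> ennreal C * orlicz_norm \<Phi> x" by (intro mult_left_mono) auto
  then show ?thesis
    using C by (simp add: ennreal_times_divide ennreal_mult_divide_eq mult.commute[of "ennreal C" z])
qed

text \<open>Holds because \<open>\<bar>u\<bar> \<le> 1 + u^2 \<le> exp (u^2)\<close>, whose integral
  is at most 2 at an admissible scale. Together with \<open>ri_L1_norm_le\<close> it identifies
  limits taken in G with limits taken in E.\<close>

lemma L1_norm_le_orlicz_exp_square:
  assumes x: "x \<in> borel_measurable unit_leb"
  shows "L1_norm x \<le> ennreal 2 * orlicz_norm exp_square x"
proof (rule le_orlicz_normI)
  fix l :: real
  assume l: "0 < l" "(\<integral>\<^sup>+ t. ennreal (exp_square (x t / l)) \<partial>unit_leb) \<le> 1"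
  have pt: "\<bar>u\<bar> \<le> l * (exp_square (u / l) + 1)" for u
  proof -
    have "\<bar>u/l\<bar> \<le> 1 + (u/l)\<^sup>2"
      using zero_le_power2[of "\<bar>u/l\<bar> - 1"] zero_le_power2[of "u/l"]
      unfolding power2_diff power2_abs mult_1_right one_power2 by linarith
    also have "\<dots> \<le> exp ((u/l)\<^sup>2)" by (rule exp_ge_add_one_self)
    finally show ?thesis using l(1) by (simp add: abs_divide field_simps)
  qed
  have "L1_norm x \<le> (\<integral>\<^sup>+ t. ennreal l * (ennreal (exp_square (x t / l)) + 1) \<partial>unit_leb)"
    unfolding L1_norm_def
  proof (rule nn_integral_mono)
    fix t
    have "ennreal \<bar>x t\<bar> \<le> ennreal (l * (exp_square (x t / l) + 1))"
      using pt by (rule ennreal_leI)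
    also have "\<dots> = ennreal l * (ennreal (exp_square (x t / l)) + 1)"
      using l(1) by (subst ennreal_mult) (auto simp flip: ennreal_plus ennreal_1)
    finally show "ennreal \<bar>x t\<bar> \<le> ennreal l * (ennreal (exp_square (x t / l)) + 1)" .
  qed
  also have "\<dots> = ennreal l * ((\<integral>\<^sup>+ t. ennreal (exp_square (x t / l)) \<partial>unit_leb) + 1)"
    using x by (subst nn_integral_cmult) (auto simp: nn_integral_add emeasure_unit_leb)
  also have "\<dots> \<le> ennreal l * (1 + 1)"
    using l(2) by (intro mult_left_mono add_mono) auto
  also have "\<dots> = ennreal (2 * l)" using l(1) by (simp add: ennreal_mult mult.commute)
  finally show "L1_norm x \<le> ennreal (2 * l)" .
qed simp

lemma ri_L1_norm_le:
  assumes E: "ri_space E" and x: "x \<in> borel_measurable unit_leb"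
  shows "L1_norm x \<le> E x"
proof (cases "E x = \<infinity>")
  case False
  have nf: "normed_function_space E" using E unfolding ri_space_def banach_function_space_def by (elim conjE)
  have xc: "x \<in> carrier_of E" using False x by (auto simp: carrier_of_def less_top)
  obtain r where r: "E x = ennreal r" "0 \<le> r" using False by (cases "E x") auto
  \<comment> \<open>The inclusion norm only speaks about the unit ball, so \<open>x\<close> has to
    be normalized; norm 0 is settled by definiteness instead.\<close>
  show ?thesis
  proof (cases "r = 0")
    case True
    then have "AE t in unit_leb. x t = 0" using r nf x by (auto simp: normed_function_space_def)
    then have "AE t in unit_leb. ennreal \<bar>x t\<bar> = 0" by eventually_elim simp
    then have "L1_norm x = 0" unfolding L1_norm_def using x by (subst nn_integral_0_iff_AE) auto
    then show ?thesis by simp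
  next
    case rn: False
    let ?z = "\<lambda>t. (1/r) * x t"
    have Ez: "E ?z = 1"
    proof -
      have "E ?z = ennreal \<bar>1/r\<bar> * E x" using nf xc unfolding normed_function_space_def by blast
      also have "\<dots> = 1" using r rn by (simp flip: ennreal_mult)
      finally show ?thesis .
    qed
    have "?z \<in> carrier_of E" using x Ez by (auto simp: carrier_of_def)
    then have "L1_norm ?z \<le> inclusion_norm E L1_norm"
      using Ez unfolding inclusion_norm_def by (intro SUP_upper) auto
    moreover have "inclusion_norm E L1_norm = 1" using E unfolding ri_space_def by (elim conjE)
    ultimately have z1: "L1_norm ?z \<le> 1" by simp
    have "L1_norm x = (\<integral>\<^sup>+ t. ennreal r * ennreal \<bar>?z t\<bar> \<partial>unit_leb)"
      unfolding L1_norm_def using r rn by (intro nn_integral_cong) (auto simp: abs_mult simp flip: ennreal_mult)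
    also have "\<dots> = ennreal r * L1_norm ?z" unfolding L1_norm_def using x by (subst nn_integral_cmult) auto
    also have "\<dots> \<le> ennreal r * 1" using z1 by (intro mult_left_mono) auto
    finally show ?thesis using r by simp
  qed
qed simp

lemma ri_bounded_carrier:
  assumes E: "ri_space E" and x: "x \<in> borel_measurable unit_leb"
    and b: "\<And>t. t \<in> {0..1} \<Longrightarrow> \<bar>x t\<bar> \<le> b"
  shows "x \<in> carrier_of E"
proof -
  have "Linf_norm x \<le> ennreal b"
    unfolding Linf_norm_def using x b by (intro esssup_I) (auto simp: AE_restrict_space_iff ennreal_leI)
  then have "x \<in> carrier_of Linf_norm" using x by (auto simp: carrier_of_def le_less_trans)
  moreover have "carrier_of Linf_norm \<subseteq> carrier_of E" using E unfolding ri_space_def by (elim conjE)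
  ultimately show ?thesis by blast
qed

section \<open>Rademacher sums\<close>

lemma nn_integral_unit_leb:
  assumes "f \<in> borel_measurable borel"
  shows "(\<integral>\<^sup>+ t. f t \<partial>unit_leb) = (\<integral>\<^sup>+ t. f t * indicator {0..1} t \<partial>lborel)"
  using assms by (simp add: nn_integral_restrict_space nn_integral_completion)

lemma AE_unit_leb:
  assumes "AE t in lborel. P t"
  shows "AE t in unit_leb. P t"
  using AE_completion[OF assms] by (auto simp: AE_restrict_space_iff elim: eventually_mono)

text \<open>The first Rademacher function records the half in which a point lies, and each half is
  an affine copy of the whole interval. This self-similarity plays the part of independence of the
  signs.\<close>

lemma nn_integral_unit_leb_halves:
  fixes f :: "real \<Rightarrow> ennreal"
  assumes f [measurable]: "f \<in> borel_measurable borel"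
  shows "(\<integral>\<^sup>+ t. f t \<partial>unit_leb) =
    ennreal (1/2) * ((\<integral>\<^sup>+ t. f (t / 2) \<partial>unit_leb) + (\<integral>\<^sup>+ t. f ((t + 1) / 2) \<partial>unit_leb))"
proof -
  let ?L = "indicator {0..1/2} :: real \<Rightarrow> ennreal" and ?R = "indicator {1/2..1} :: real \<Rightarrow> ennreal"
  have "(\<integral>\<^sup>+ t. f t \<partial>unit_leb) = (\<integral>\<^sup>+ t. f t * ?L t + f t * ?R t \<partial>lborel)"
    unfolding nn_integral_unit_leb[OF f]
    by (intro nn_integral_cong_AE) (use AE_lborel_singleton[of "1/2::real"] in eventually_elim, auto simp: indicator_def)
  also have "\<dots> = (\<integral>\<^sup>+ t. f t * ?L t \<partial>lborel) + (\<integral>\<^sup>+ t. f t * ?R t \<partial>lborel)"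
    by (intro nn_integral_add) auto
  also have "(\<integral>\<^sup>+ t. f t * ?L t \<partial>lborel) = ennreal (1/2) * (\<integral>\<^sup>+ t. f (0 + 1/2 * t) * ?L (0 + 1/2 * t) \<partial>lborel)"
    by (subst nn_integral_real_affine[where c = "1/2" and t = 0]) auto
  also have "(\<integral>\<^sup>+ t. f (0 + 1/2 * t) * ?L (0 + 1/2 * t) \<partial>lborel) = (\<integral>\<^sup>+ t. f (t / 2) \<partial>unit_leb)"
    by (subst nn_integral_unit_leb) (auto intro!: nn_integral_cong simp: indicator_def)
  also have "(\<integral>\<^sup>+ t. f t * ?R t \<partial>lborel) = ennreal (1/2) * (\<integral>\<^sup>+ t. f (1/2 + 1/2 * t) * ?R (1/2 + 1/2 * t) \<partial>lborel)"
    by (subst nn_integral_real_affine[where c = "1/2" and t = "1/2"]) auto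
  also have "(\<integral>\<^sup>+ t. f (1/2 + 1/2 * t) * ?R (1/2 + 1/2 * t) \<partial>lborel) = (\<integral>\<^sup>+ t. f ((t + 1) / 2) \<partial>unit_leb)"
    by (subst nn_integral_unit_leb) (auto intro!: nn_integral_cong simp: indicator_def add_divide_distrib add.commute)
  finally show ?thesis by (simp add: distrib_left)
qed

lemma rademacher_borel [measurable]: "rademacher n \<in> borel_measurable borel"
  unfolding rademacher_def by measurable

lemma rademacher_measurable: "rademacher n \<in> borel_measurable unit_leb"
  by (rule borel_imp_unit_leb) measurable

lemma abs_rademacher_le: "\<bar>rademacher n t\<bar> \<le> 1"
  by (simp add: rademacher_def sgn_real_def)

lemma rademacher_half: "rademacher (Suc i) (t / 2) = rademacher i t"
  by (simp add: rademacher_def mult.assoc)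

text \<open>Index 0 enters through \<open>rademacher_half\<close> with \<open>i = 0\<close>: it
  gives the value of the first Rademacher function on the left half.\<close>

lemma rademacher_zero: "0 < t \<Longrightarrow> t < 1 \<Longrightarrow> rademacher 0 t = 1"
  using sin_gt_zero[of "pi * t"] by (simp add: rademacher_def)

text \<open>The argument of the sine is shifted by \<open>2 ^ i * pi\<close>, a multiple of the
  period only if \<open>0 < i\<close>. For \<open>i = 0\<close> the shift is half a period and the
  sign flips, as in the next lemma.\<close>

lemma rademacher_upper_half:
  assumes "0 < i"
  shows "rademacher (Suc i) ((t + 1) / 2) = rademacher i t"
proof -
  have "2 ^ Suc i * pi * ((t + 1) / 2) = 2 ^ i * pi * t + real (2 ^ i) * pi"
    by (simp add: field_simps)
  moreover have "(-1::real) ^ (2 ^ i) = 1" using assms by simp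
  ultimately show ?thesis unfolding rademacher_def by (simp only: sin_add cos_npi sin_npi) simp
qed

lemma rademacher_one_upper_half:
  assumes "0 < t" "t < 1"
  shows "rademacher (Suc 0) ((t + 1) / 2) = -1"
proof -
  have "0 < sin (pi * t)" using assms by (intro sin_gt_zero) auto
  moreover have "2 ^ Suc 0 * pi * ((t + 1) / 2) = pi * t + pi" by (simp add: field_simps)
  ultimately show ?thesis unfolding rademacher_def by (auto simp: sin_add)
qed

text \<open>The sine vanishes only at dyadic rationals, which form a countable set.\<close>

lemma AE_rademacher:
  "AE t in unit_leb. \<forall>i. rademacher i t \<in> {-1, 1}"
proof -
  let ?Z = "\<Union>i::nat. range (\<lambda>k::int. real_of_int k / 2 ^ i)"
  have "countable ?Z" by auto
  then have "?Z \<in> null_sets lborel" by (rule countable_imp_null_set_lborel)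
  then have "AE t in lborel. t \<notin> ?Z" by (rule AE_not_in)
  then have "AE t in unit_leb. t \<notin> ?Z" by (rule AE_unit_leb)
  then show ?thesis
  proof eventually_elim
    case (elim t)
    have "sin (2 ^ i * pi * t) \<noteq> 0" for i
    proof
      assume "sin (2 ^ i * pi * t) = 0"
      then obtain k :: int where "2 ^ i * pi * t = real_of_int k * pi"
        by (auto simp: sin_zero_iff_int2)
      then have "t = real_of_int k / 2 ^ i" by (simp add: field_simps)
      then show False using elim by auto
    qed
    then show ?case by (auto simp: rademacher_def sgn_real_def)
  qed
qed

lemma sum_Icc_Suc_shift: "(\<Sum>i=1..Suc n. g i) = g 1 + (\<Sum>i=1..n. g (Suc i))" for g :: "nat \<Rightarrow> real"
  by (induction n) (simp_all add: add.assoc)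

text \<open>Conditioning on the first sign. It is absorbed into the shift \<open>s\<close>, which is
  why the inductive statements about Rademacher sums carry an arbitrary shift.\<close>

lemma nn_integral_rademacher_Suc:
  fixes \<phi> :: "real \<Rightarrow> ennreal"
  assumes [measurable]: "\<phi> \<in> borel_measurable borel"
  shows "(\<integral>\<^sup>+ t. \<phi> (s + (\<Sum>i=1..Suc n. a i * rademacher i t)) \<partial>unit_leb) =
    ennreal (1/2) * ((\<integral>\<^sup>+ t. \<phi> (s + a 1 + (\<Sum>i=1..n. a (Suc i) * rademacher i t)) \<partial>unit_leb)
      + (\<integral>\<^sup>+ t. \<phi> (s - a 1 + (\<Sum>i=1..n. a (Suc i) * rademacher i t)) \<partial>unit_leb))"
proof -
  have ae: "AE t in unit_leb. 0 < t \<and> t < 1"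
  proof -
    have "AE t in unit_leb. t \<noteq> 0" "AE t in unit_leb. t \<noteq> 1"
      by (intro AE_unit_leb AE_lborel_singleton)+
    moreover have "AE t in unit_leb. t \<in> {0..1}" using AE_space[of unit_leb] by simp
    ultimately show ?thesis by eventually_elim auto
  qed
  have "(\<integral>\<^sup>+ t. \<phi> (s + (\<Sum>i=1..Suc n. a i * rademacher i (t / 2))) \<partial>unit_leb)
      = (\<integral>\<^sup>+ t. \<phi> (s + a 1 + (\<Sum>i=1..n. a (Suc i) * rademacher i t)) \<partial>unit_leb)"
    unfolding sum_Icc_Suc_shift using ae
    by (intro nn_integral_cong_AE, eventually_elim) (simp add: rademacher_half rademacher_zero add.assoc)
  moreover have "(\<integral>\<^sup>+ t. \<phi> (s + (\<Sum>i=1..Suc n. a i * rademacher i ((t + 1) / 2))) \<partial>unit_leb)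
      = (\<integral>\<^sup>+ t. \<phi> (s - a 1 + (\<Sum>i=1..n. a (Suc i) * rademacher i t)) \<partial>unit_leb)"
    unfolding sum_Icc_Suc_shift using ae
    by (intro nn_integral_cong_AE, eventually_elim) (simp add: rademacher_upper_half rademacher_one_upper_half algebra_simps)
  ultimately show ?thesis
    by (subst nn_integral_unit_leb_halves) simp_all
qed

text \<open>Changing the sign of the leading coefficient only exchanges the two summands of the
  recursion.\<close>

lemma nn_integral_rademacher_abs:
  fixes \<phi> :: "real \<Rightarrow> ennreal"
  assumes [measurable]: "\<phi> \<in> borel_measurable borel"
  shows "(\<integral>\<^sup>+ t. \<phi> (s + (\<Sum>i=1..n. \<bar>a i\<bar> * rademacher i t)) \<partial>unit_leb) =
    (\<integral>\<^sup>+ t. \<phi> (s + (\<Sum>i=1..n. a i * rademacher i t)) \<partial>unit_leb)"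
proof (induction n arbitrary: s a)
  case (Suc n)
  show ?case
    unfolding nn_integral_rademacher_Suc[OF assms] Suc.IH
    by (cases "0 \<le> a 1") (simp_all add: add.commute)
qed simp

section \<open>Gaussian domination, moments and Khinchine's inequality\<close>

lemma cosh_le_exp_half_square: "cosh y \<le> exp (y\<^sup>2 / 2)" for y :: real
proof -
  have pos: "cosh x \<le> exp (x\<^sup>2 / 2)" if x: "0 < x" for x :: real
  proof -
    have pos: "0 < 1 + exp (2 * x)" by (simp add: add_pos_pos)
    \<comment> \<open>Hoeffding's bound for a fair two-point variable with gap \<open>2 * x\<close>;
      the left side equals \<open>ln (cosh x)\<close>.\<close>
    have "-(2 * x) * (1/2) + ln (1 + (1/2) * (exp (2 * x) - 1)) \<le> (2 * x)\<^sup>2 / 8"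
      using Hoeffdings_lemma_aux[of "2 * x" "1/2"] x by simp
    then have "ln ((1 + exp (2 * x)) / 2) \<le> x + x\<^sup>2 / 2"
      by (simp add: field_simps power2_eq_square)
    then have "(1 + exp (2 * x)) / 2 \<le> exp (x + x\<^sup>2 / 2)"
      using pos by (metis exp_le_cancel_iff exp_ln half_gt_zero)
    then have "exp (-x) * ((1 + exp (2 * x)) / 2) \<le> exp (-x) * exp (x + x\<^sup>2 / 2)"
      by (intro mult_left_mono) auto
    also have "\<dots> = exp (x\<^sup>2 / 2)" by (simp flip: exp_add)
    also have "exp (-x) * ((1 + exp (2 * x)) / 2) = cosh x"
      by (simp add: cosh_def distrib_left flip: exp_add)
    finally show ?thesis .
  qed
  show ?thesis using pos[of y] pos[of "-y"] by (cases y "0 :: real" rule: linorder_cases) auto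
qed

text \<open>The right side is the mean of \<open>exp (b * (s + a * g)^2)\<close> for a standard
  Gaussian \<open>g\<close>, a form that reproduces itself under iteration. With
  \<open>x = 2 * b * a^2\<close>, the bound on \<open>cosh\<close> reduces the claim to
  \<open>1 + x \<le> 1 / (1 - x)\<close> and
  \<open>exp (x / 2) \<le> 1 / sqrt (1 - x)\<close>.\<close>

lemma exp_square_two_point:
  fixes a b s :: real
  assumes b: "0 \<le> b" and lt: "2 * b * a\<^sup>2 < 1"
  shows "(exp (b * (s + a)\<^sup>2) + exp (b * (s - a)\<^sup>2)) / 2
    \<le> exp (b * s\<^sup>2 / (1 - 2 * b * a\<^sup>2)) / sqrt (1 - 2 * b * a\<^sup>2)"
proof -
  define x where "x = 2 * b * a\<^sup>2"
  have x: "0 \<le> x" "x < 1" using b lt by (auto simp: x_def)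
  have "(exp (b * (s + a)\<^sup>2) + exp (b * (s - a)\<^sup>2)) / 2
      = exp (b * s\<^sup>2 + x / 2) * cosh (2 * b * s * a)"
    by (simp add: cosh_def x_def power2_sum power2_diff algebra_simps add_divide_distrib flip: exp_add)
  also have "\<dots> \<le> exp (b * s\<^sup>2 + x / 2) * exp ((2 * b * s * a)\<^sup>2 / 2)"
    by (intro mult_left_mono cosh_le_exp_half_square) auto
  also have "\<dots> = exp (b * s\<^sup>2 * (1 + x)) * exp (x / 2)"
    by (simp add: x_def power2_eq_square algebra_simps flip: exp_add)
  also have "\<dots> \<le> exp (b * s\<^sup>2 / (1 - x)) * (1 / sqrt (1 - x))"
  proof (rule mult_mono)
    have "1 + x \<le> 1 / (1 - x)" using x by (simp add: field_simps)
    then have "b * s\<^sup>2 * (1 + x) \<le> b * s\<^sup>2 * (1 / (1 - x))" using b by (intro mult_left_mono) auto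
    then show "exp (b * s\<^sup>2 * (1 + x)) \<le> exp (b * s\<^sup>2 / (1 - x))" by simp
    have "sqrt (1 - x) \<le> sqrt (exp (- x))"
      using exp_ge_add_one_self[of "-x"] by (intro real_sqrt_le_mono) simp
    also have "\<dots> = exp (- x / 2)" by (intro real_sqrt_unique) (auto simp: power2_eq_square simp flip: exp_add)
    finally have "exp (x / 2) * sqrt (1 - x) \<le> exp (x / 2) * exp (- x / 2)" by (intro mult_left_mono) auto
    then show "exp (x / 2) \<le> 1 / sqrt (1 - x)" using x by (simp add: pos_le_divide_eq flip: exp_add)
  qed auto
  finally show ?thesis by (simp add: x_def)
qed

lemma half_ennreal_plus:
  "0 \<le> x \<Longrightarrow> 0 \<le> y \<Longrightarrow> ennreal (1/2) * (ennreal x + ennreal y) = ennreal ((x + y) / 2)"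
  by (subst ennreal_plus[symmetric], simp_all only:, subst ennreal_mult[symmetric]) simp_all

text \<open>For a standard Gaussian in place of the sum there would be equality.\<close>

lemma rademacher_exp_square_le:
  assumes "0 \<le> \<beta>" "2 * \<beta> * (\<Sum>i=1..n. (a i)\<^sup>2) < 1"
  shows "(\<integral>\<^sup>+ t. ennreal (exp (\<beta> * (s + (\<Sum>i=1..n. a i * rademacher i t))\<^sup>2)) \<partial>unit_leb)
    \<le> ennreal (exp (\<beta> * s\<^sup>2 / (1 - 2 * \<beta> * (\<Sum>i=1..n. (a i)\<^sup>2))) / sqrt (1 - 2 * \<beta> * (\<Sum>i=1..n. (a i)\<^sup>2)))"
  using assms(2)
proof (induction n arbitrary: s a)
  case 0
  then show ?case by simp
next
  case (Suc n)
  define \<sigma> where "\<sigma> = (\<Sum>i=1..n. (a (Suc i))\<^sup>2)"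
  define D where "D = 1 - 2 * \<beta> * \<sigma>"
  have S: "(\<Sum>i=1..Suc n. (a i)\<^sup>2) = (a 1)\<^sup>2 + \<sigma>" by (simp only: sum_Icc_Suc_shift \<sigma>_def)
  have lt: "2 * \<beta> * (a 1)\<^sup>2 < D" using Suc.prems unfolding S D_def by (simp add: distrib_left)
  have "0 \<le> 2 * \<beta> * (a 1)\<^sup>2" using assms(1) by simp
  then have D: "0 < D" using lt by linarith
  have IH: "(\<integral>\<^sup>+ t. ennreal (exp (\<beta> * (r + (\<Sum>i=1..n. a (Suc i) * rademacher i t))\<^sup>2)) \<partial>unit_leb)
    \<le> ennreal (exp (\<beta> * r\<^sup>2 / D) / sqrt D)" for r
    using Suc.IH[of "\<lambda>i. a (Suc i)" r] D unfolding D_def \<sigma>_def by simp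
  have rec: "(\<integral>\<^sup>+ t. ennreal (exp (\<beta> * (s + (\<Sum>i=1..Suc n. a i * rademacher i t))\<^sup>2)) \<partial>unit_leb) =
     ennreal (1/2) * ((\<integral>\<^sup>+ t. ennreal (exp (\<beta> * (s + a 1 + (\<Sum>i=1..n. a (Suc i) * rademacher i t))\<^sup>2)) \<partial>unit_leb)
      + (\<integral>\<^sup>+ t. ennreal (exp (\<beta> * (s - a 1 + (\<Sum>i=1..n. a (Suc i) * rademacher i t))\<^sup>2)) \<partial>unit_leb))"
    by (rule nn_integral_rademacher_Suc[where \<phi> = "\<lambda>u. ennreal (exp (\<beta> * u\<^sup>2))"]) measurable
  have "(\<integral>\<^sup>+ t. ennreal (exp (\<beta> * (s + (\<Sum>i=1..Suc n. a i * rademacher i t))\<^sup>2)) \<partial>unit_leb)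
    \<le> ennreal (1/2) * (ennreal (exp (\<beta> * (s + a 1)\<^sup>2 / D) / sqrt D) + ennreal (exp (\<beta> * (s - a 1)\<^sup>2 / D) / sqrt D))"
    unfolding rec by (intro mult_left_mono add_mono IH) auto
  also have "\<dots> = ennreal ((exp ((\<beta>/D) * (s + a 1)\<^sup>2) + exp ((\<beta>/D) * (s - a 1)\<^sup>2)) / 2 / sqrt D)"
    using D by (subst half_ennreal_plus) (auto simp: add_divide_distrib mult.commute)
  also have "\<dots> \<le> ennreal (exp ((\<beta>/D) * s\<^sup>2 / (1 - 2 * (\<beta>/D) * (a 1)\<^sup>2)) / sqrt (1 - 2 * (\<beta>/D) * (a 1)\<^sup>2) / sqrt D)"
    using D assms(1) lt by (intro ennreal_leI divide_right_mono exp_square_two_point) (auto simp: field_simps)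
  \<comment> \<open>The two-point bound was applied with \<open>\<beta>/D\<close> in place of
    \<open>\<beta>\<close>, so the factors \<open>D\<close> cancel and the denominators telescope to
    the full sum of squares.\<close>
  also have "1 - 2 * (\<beta>/D) * (a 1)\<^sup>2 = (D - 2 * \<beta> * (a 1)\<^sup>2) / D" using D by (simp add: field_simps)
  also have "exp ((\<beta>/D) * s\<^sup>2 / ((D - 2 * \<beta> * (a 1)\<^sup>2) / D)) / sqrt ((D - 2 * \<beta> * (a 1)\<^sup>2) / D) / sqrt D
      = exp (\<beta> * s\<^sup>2 / (D - 2 * \<beta> * (a 1)\<^sup>2)) / sqrt (D - 2 * \<beta> * (a 1)\<^sup>2)"
    using D by (simp add: real_sqrt_divide)
  also have "D - 2 * \<beta> * (a 1)\<^sup>2 = 1 - 2 * \<beta> * (\<Sum>i=1..Suc n. (a i)\<^sup>2)"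
    unfolding S D_def by (simp add: algebra_simps)
  finally show ?case .
qed

lemma rademacher_second_moment:
  "(\<integral>\<^sup>+ t. ennreal ((s + (\<Sum>i=1..n. a i * rademacher i t))\<^sup>2) \<partial>unit_leb) = ennreal (s\<^sup>2 + (\<Sum>i=1..n. (a i)\<^sup>2))"
proof (induction n arbitrary: s a)
  case (Suc n)
  define \<sigma> where "\<sigma> = (\<Sum>i=1..n. (a (Suc i))\<^sup>2)"
  have \<sigma>: "0 \<le> \<sigma>" by (simp add: \<sigma>_def sum_nonneg)
  have IH: "(\<integral>\<^sup>+ t. ennreal ((r + (\<Sum>i=1..n. a (Suc i) * rademacher i t))\<^sup>2) \<partial>unit_leb) = ennreal (r\<^sup>2 + \<sigma>)" for r
    unfolding \<sigma>_def by (rule Suc.IH)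
  have "(\<integral>\<^sup>+ t. ennreal ((s + (\<Sum>i=1..Suc n. a i * rademacher i t))\<^sup>2) \<partial>unit_leb)
    = ennreal (1/2) * (ennreal ((s + a 1)\<^sup>2 + \<sigma>) + ennreal ((s - a 1)\<^sup>2 + \<sigma>))"
    unfolding IH[symmetric]
    by (rule nn_integral_rademacher_Suc[where \<phi> = "\<lambda>u. ennreal (u\<^sup>2)"]) measurable
  also have "\<dots> = ennreal ((((s + a 1)\<^sup>2 + \<sigma>) + ((s - a 1)\<^sup>2 + \<sigma>)) / 2)"
    using \<sigma> by (intro half_ennreal_plus) auto
  also have "(((s + a 1)\<^sup>2 + \<sigma>) + ((s - a 1)\<^sup>2 + \<sigma>)) / 2 = s\<^sup>2 + (\<Sum>i=1..Suc n. (a i)\<^sup>2)"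
    unfolding sum_Icc_Suc_shift \<sigma>_def[symmetric] by (simp add: power2_sum power2_diff)
  finally show ?case .
qed simp

text \<open>The bound is the fourth moment of a Gaussian with mean \<open>s\<close> and variance
  \<open>\<Sum>i=1..n. (a i)^2\<close>. A sign has fourth moment 1 instead of 3, so each step of the
  induction has \<open>2 * (a 1) ^ 4\<close> to spare.\<close>

lemma rademacher_fourth_moment:
  "(\<integral>\<^sup>+ t. ennreal ((s + (\<Sum>i=1..n. a i * rademacher i t)) ^ 4) \<partial>unit_leb)
    \<le> ennreal (s ^ 4 + 6 * s\<^sup>2 * (\<Sum>i=1..n. (a i)\<^sup>2) + 3 * (\<Sum>i=1..n. (a i)\<^sup>2)\<^sup>2)"
proof (induction n arbitrary: s a)
  case (Suc n)
  define \<sigma> where "\<sigma> = (\<Sum>i=1..n. (a (Suc i))\<^sup>2)"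
  define g where "g r = r ^ 4 + 6 * r\<^sup>2 * \<sigma> + 3 * \<sigma>\<^sup>2" for r :: real
  have \<sigma>: "0 \<le> \<sigma>" by (simp add: \<sigma>_def sum_nonneg)
  have g0: "0 \<le> g r" for r using \<sigma> by (simp add: g_def)
  have IH: "(\<integral>\<^sup>+ t. ennreal ((r + (\<Sum>i=1..n. a (Suc i) * rademacher i t)) ^ 4) \<partial>unit_leb) \<le> ennreal (g r)" for r
    unfolding \<sigma>_def g_def by (rule Suc.IH)
  have "(\<integral>\<^sup>+ t. ennreal ((s + (\<Sum>i=1..Suc n. a i * rademacher i t)) ^ 4) \<partial>unit_leb)
    = ennreal (1/2) * ((\<integral>\<^sup>+ t. ennreal ((s + a 1 + (\<Sum>i=1..n. a (Suc i) * rademacher i t)) ^ 4) \<partial>unit_leb)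
      + (\<integral>\<^sup>+ t. ennreal ((s - a 1 + (\<Sum>i=1..n. a (Suc i) * rademacher i t)) ^ 4) \<partial>unit_leb))"
    by (rule nn_integral_rademacher_Suc[where \<phi> = "\<lambda>u. ennreal (u ^ 4)"]) measurable
  also have "\<dots> \<le> ennreal (1/2) * (ennreal (g (s + a 1)) + ennreal (g (s - a 1)))"
    by (intro mult_left_mono add_mono IH) auto
  also have "\<dots> = ennreal ((g (s + a 1) + g (s - a 1)) / 2)"
    using g0 by (intro half_ennreal_plus)
  also have "\<dots> \<le> ennreal (s ^ 4 + 6 * s\<^sup>2 * ((a 1)\<^sup>2 + \<sigma>) + 3 * ((a 1)\<^sup>2 + \<sigma>)\<^sup>2)"
  proof (rule ennreal_leI)
    have "(g (s + a 1) + g (s - a 1)) / 2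
      = s ^ 4 + 6 * s\<^sup>2 * ((a 1)\<^sup>2 + \<sigma>) + 3 * ((a 1)\<^sup>2 + \<sigma>)\<^sup>2 - 2 * (a 1) ^ 4"
      by (simp add: g_def power4_eq_xxxx power2_eq_square algebra_simps)
    then show "(g (s + a 1) + g (s - a 1)) / 2 \<le> s ^ 4 + 6 * s\<^sup>2 * ((a 1)\<^sup>2 + \<sigma>) + 3 * ((a 1)\<^sup>2 + \<sigma>)\<^sup>2"
      by simp
  qed
  also have "(a 1)\<^sup>2 + \<sigma> = (\<Sum>i=1..Suc n. (a i)\<^sup>2)" unfolding sum_Icc_Suc_shift \<sigma>_def ..
  finally show ?case .
qed simp

lemma rademacher_sum_measurable:
  "(\<lambda>t. \<Sum>i=1..n. a i * rademacher i t) \<in> borel_measurable unit_leb"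
  by (rule borel_imp_unit_leb) measurable

text \<open>Integrating \<open>u^2 / \<sigma> \<le> \<bar>u\<bar> + u^4 / (4 * \<sigma>^3)\<close>
  over the sum and inserting the second and fourth moments gives
  \<open>\<sigma> \<le> L1_norm S + 3/4 * \<sigma>\<close>.\<close>

lemma L1_norm_rademacher_ge:
  "ennreal (sqrt (\<Sum>i=1..n. (a i)\<^sup>2) / 4) \<le> L1_norm (\<lambda>t. \<Sum>i=1..n. a i * rademacher i t)"
proof (cases "(\<Sum>i=1..n. (a i)\<^sup>2) = 0")
  case False
  define \<sigma> where "\<sigma> = sqrt (\<Sum>i=1..n. (a i)\<^sup>2)"
  define S where "S = (\<lambda>t. \<Sum>i=1..n. a i * rademacher i t)"
  have \<sigma>2: "(\<Sum>i=1..n. (a i)\<^sup>2) = \<sigma>\<^sup>2" by (simp add: \<sigma>_def sum_nonneg)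
  have \<sigma>: "0 < \<sigma>" using False by (simp add: \<sigma>_def order_less_le sum_nonneg)
  have [measurable]: "S \<in> borel_measurable unit_leb" unfolding S_def by (rule rademacher_sum_measurable)
  have cubic: "x \<le> 1 + x ^ 3 / 4" if "0 \<le> x" for x :: real
  proof -
    \<comment> \<open>\<open>6/5\<close> is a rational point near the minimizer
      \<open>2 / sqrt 3\<close> of \<open>1 + x^3/4 - x\<close>; the product is the cubic minus its
      tangent there.\<close>
    have "0 \<le> (x - 6/5)\<^sup>2 * (x + 12/5)" using that by simp
    also have "\<dots> = x ^ 3 - 108/25 * x + 432/125" by (simp add: power2_eq_square power3_eq_cube field_simps)
    finally show ?thesis using that by simp
  qed
  have pt: "u\<^sup>2 / \<sigma> \<le> \<bar>u\<bar> + u ^ 4 / (4 * \<sigma> ^ 3)" for u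
  proof -
    have "\<bar>u\<bar> * (\<bar>u\<bar> / \<sigma>) \<le> \<bar>u\<bar> * (1 + (\<bar>u\<bar> / \<sigma>) ^ 3 / 4)"
      using \<sigma> by (intro mult_left_mono cubic) auto
    then show ?thesis
      by (simp add: power2_eq_square power3_eq_cube power4_eq_xxxx field_simps)
  qed
  have m2: "(\<integral>\<^sup>+ t. ennreal ((S t)\<^sup>2) \<partial>unit_leb) = ennreal (\<sigma>\<^sup>2)"
    using rademacher_second_moment[of 0 a n] unfolding \<sigma>2 by (simp add: S_def)
  have m4: "(\<integral>\<^sup>+ t. ennreal ((S t) ^ 4) \<partial>unit_leb) \<le> ennreal (3 * \<sigma> ^ 4)"
    using rademacher_fourth_moment[of 0 a n] unfolding \<sigma>2 by (simp add: S_def flip: power_mult)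
  have "ennreal \<sigma> = ennreal (1/\<sigma>) * ennreal (\<sigma>\<^sup>2)"
    using \<sigma> by (simp add: power2_eq_square flip: ennreal_mult)
  also have "\<dots> = (\<integral>\<^sup>+ t. ennreal (1/\<sigma>) * ennreal ((S t)\<^sup>2) \<partial>unit_leb)"
    unfolding m2[symmetric] by (subst nn_integral_cmult) auto
  also have "\<dots> \<le> (\<integral>\<^sup>+ t. ennreal \<bar>S t\<bar> + ennreal (1 / (4 * \<sigma> ^ 3)) * ennreal ((S t) ^ 4) \<partial>unit_leb)"
    using pt \<sigma> by (intro nn_integral_mono) (simp flip: ennreal_plus ennreal_mult)
  also have "\<dots> = L1_norm S + ennreal (1 / (4 * \<sigma> ^ 3)) * (\<integral>\<^sup>+ t. ennreal ((S t) ^ 4) \<partial>unit_leb)"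
    unfolding L1_norm_def by (subst nn_integral_add) (auto simp: nn_integral_cmult)
  also have "\<dots> \<le> L1_norm S + ennreal (1 / (4 * \<sigma> ^ 3)) * ennreal (3 * \<sigma> ^ 4)"
    using m4 by (intro add_mono mult_left_mono) auto
  also have "ennreal (1 / (4 * \<sigma> ^ 3)) * ennreal (3 * \<sigma> ^ 4) = ennreal (3/4 * \<sigma>)"
    using \<sigma> by (simp add: power4_eq_xxxx power3_eq_cube flip: ennreal_mult)
  finally have "ennreal (\<sigma> / 4) + ennreal (3/4 * \<sigma>) \<le> L1_norm S + ennreal (3/4 * \<sigma>)"
    using \<sigma> by (simp flip: ennreal_plus)
  then have "ennreal (\<sigma> / 4) \<le> L1_norm S"
    by (subst (asm) (1 2) add.commute) (simp add: ennreal_add_left_cancel_le)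
  then show ?thesis by (simp add: \<sigma>_def S_def)
qed simp

lemma orlicz_norm_rademacher_le:
  "orlicz_norm exp_square (\<lambda>t. \<Sum>i=1..n. a i * rademacher i t) \<le> ennreal (2 * sqrt (\<Sum>i=1..n. (a i)\<^sup>2))"
proof (cases "(\<Sum>i=1..n. (a i)\<^sup>2) = 0")
  case True
  then have "\<forall>i\<in>{1..n}. a i = 0" by (subst (asm) sum_nonneg_eq_0_iff) auto
  then have "(\<lambda>t. \<Sum>i=1..n. a i * rademacher i t) = (\<lambda>t. 0)"
    by (intro ext sum.neutral) auto
  then show ?thesis by (simp only: orlicz_norm_zero[OF orlicz_function_exp_square] zero_le)
next
  case False
  define \<sigma> where "\<sigma> = sqrt (\<Sum>i=1..n. (a i)\<^sup>2)"
  define S where "S = (\<lambda>t. \<Sum>i=1..n. a i * rademacher i t)"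
  have \<sigma>2: "(\<Sum>i=1..n. (a i)\<^sup>2) = \<sigma>\<^sup>2" by (simp add: \<sigma>_def sum_nonneg)
  have \<sigma>: "0 < \<sigma>" using False by (simp add: \<sigma>_def order_less_le sum_nonneg)
  have [measurable]: "S \<in> borel_measurable unit_leb" unfolding S_def by (rule rademacher_sum_measurable)
  \<comment> \<open>The scale \<open>2 * \<sigma>\<close> corresponds to
    \<open>\<beta> = 1 / (4 * \<sigma>^2)\<close>. The mean of the exponential is then at most
    \<open>sqrt 2 \<le> 2\<close>, which is what \<open>exp_square\<close> allows.\<close>
  have D: "1 - 2 * (1 / (4 * \<sigma>\<^sup>2)) * (\<Sum>i=1..n. (a i)\<^sup>2) = 1/2" unfolding \<sigma>2 using \<sigma> by simp
  then have lt: "2 * (1 / (4 * \<sigma>\<^sup>2)) * (\<Sum>i=1..n. (a i)\<^sup>2) < 1" by linarith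
  have e: "(S t / (2 * \<sigma>))\<^sup>2 = 1 / (4 * \<sigma>\<^sup>2) * (S t)\<^sup>2" for t
    by (simp add: power_divide power_mult_distrib)
  have "(\<integral>\<^sup>+ t. ennreal (exp ((S t / (2 * \<sigma>))\<^sup>2)) \<partial>unit_leb) \<le> ennreal (1 / sqrt (1/2))"
    using rademacher_exp_square_le[OF _ lt, of 0] unfolding D e unfolding S_def by simp
  also have "\<dots> \<le> ennreal 2"
  proof (rule ennreal_leI)
    have "1/2 \<le> sqrt (1/2)" by (rule real_le_rsqrt) (simp add: power2_eq_square)
    then show "1 / sqrt (1/2) \<le> 2" by (simp add: field_simps)
  qed
  finally have "(\<integral>\<^sup>+ t. 1 + ennreal (exp_square (S t / (2 * \<sigma>))) \<partial>unit_leb) \<le> 1 + 1"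
    by (simp flip: ennreal_1 ennreal_plus)
  then have "1 + (\<integral>\<^sup>+ t. ennreal (exp_square (S t / (2 * \<sigma>))) \<partial>unit_leb) \<le> 1 + 1"
    by (subst (asm) nn_integral_add) auto
  then have "(\<integral>\<^sup>+ t. ennreal (exp_square (S t / (2 * \<sigma>))) \<partial>unit_leb) \<le> 1"
    unfolding ennreal_add_left_cancel_le by simp
  then have "orlicz_norm exp_square S \<le> ennreal (2 * \<sigma>)" using \<sigma> by (intro orlicz_norm_le) auto
  then show ?thesis by (simp add: \<sigma>_def S_def)
qed

section \<open>Lewis weights\<close>

text \<open>Consists of exact functions rather than classes modulo null sets, since the kernel
  estimates below are pointwise.\<close>

definition lin_comb :: "(nat \<Rightarrow> real \<Rightarrow> real) \<Rightarrow> nat \<Rightarrow> (real \<Rightarrow> real) set" where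
  "lin_comb v k = {f. \<exists>c. f = (\<lambda>t. \<Sum>j<k. c j * v j t)}"

lemma lin_combI: "(\<lambda>t. \<Sum>j<k. c j * v j t) \<in> lin_comb v k"
  by (auto simp: lin_comb_def)

lemma lin_comb_base: "i < k \<Longrightarrow> v i \<in> lin_comb v k"
  unfolding lin_comb_def
  by (auto intro!: exI[of _ "\<lambda>j. if j = i then 1 else 0"] simp: if_distrib[of "\<lambda>x. x * _"] cong: if_cong)

lemma lin_comb_scale:
  assumes "f \<in> lin_comb v k" shows "(\<lambda>t. a * f t) \<in> lin_comb v k"
proof -
  obtain c where "f = (\<lambda>t. \<Sum>j<k. c j * v j t)" using assms by (auto simp: lin_comb_def)
  then have "(\<lambda>t. a * f t) = (\<lambda>t. \<Sum>j<k. (a * c j) * v j t)"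
    by (simp add: sum_distrib_left mult.assoc)
  then show ?thesis by (auto simp: lin_comb_def)
qed

lemma lin_comb_add:
  assumes "f \<in> lin_comb v k" "g \<in> lin_comb v k" shows "(\<lambda>t. f t + g t) \<in> lin_comb v k"
proof -
  obtain c d where "f = (\<lambda>t. \<Sum>j<k. c j * v j t)" "g = (\<lambda>t. \<Sum>j<k. d j * v j t)"
    using assms by (auto simp: lin_comb_def)
  then have "(\<lambda>t. f t + g t) = (\<lambda>t. \<Sum>j<k. (c j + d j) * v j t)"
    by (simp add: sum.distrib distrib_right)
  then show ?thesis by (auto simp: lin_comb_def)
qed

lemma lin_comb_sum:
  "(\<And>i. i < (m::nat) \<Longrightarrow> f i \<in> lin_comb v k) \<Longrightarrow> (\<lambda>t. \<Sum>i<m. c i * f i t) \<in> lin_comb v k"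
proof (induction m)
  case 0
  show ?case using lin_combI[where c = "\<lambda>_. 0"] by simp
next
  case (Suc m)
  then show ?case by (simp add: lin_comb_add lin_comb_scale)
qed

lemma lin_comb_mono:
  assumes "k \<le> m" shows "lin_comb v k \<subseteq> lin_comb v m"
proof
  fix f assume "f \<in> lin_comb v k"
  then obtain c where f: "f = (\<lambda>t. \<Sum>j<k. c j * v j t)" by (auto simp: lin_comb_def)
  have "f = (\<lambda>t. \<Sum>j<k. c j * v j t)" by fact
  also have "\<dots> \<in> lin_comb v m" using assms by (intro lin_comb_sum lin_comb_base) auto
  finally show "f \<in> lin_comb v m" .
qed

text \<open>Independence modulo null sets, in the incremental form that Gram-Schmidt
  consumes.\<close>

locale ae_independent =
  fixes M :: "real measure" and v :: "nat \<Rightarrow> real \<Rightarrow> real" and n :: nat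
  assumes integrable_v: "i < n \<Longrightarrow> integrable M (v i)"
    and indep: "k < n \<Longrightarrow> f \<in> lin_comb v k \<Longrightarrow> \<not> (AE t in M. v k t = f t)"
begin

definition envelope :: "real \<Rightarrow> real" where "envelope t = (\<Sum>j<n. \<bar>v j t\<bar>)"

text \<open>Comparability with one fixed envelope makes all weights share their zero set and keeps
  the ratio of any two bounded, so that their logarithmic distance is finite.\<close>

definition weight :: "(real \<Rightarrow> real) \<Rightarrow> bool" where
  "weight w \<longleftrightarrow> w \<in> borel_measurable M \<and> (\<exists>\<alpha>>0. \<forall>t. envelope t \<le> \<alpha> * w t \<and> w t \<le> \<alpha> * envelope t)"

text \<open>Where \<open>w\<close> vanishes so does every \<open>v i\<close>, so the junk value \<open>0 / 0 = 0\<close> is the intended one.\<close>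

definition inner :: "(real \<Rightarrow> real) \<Rightarrow> (real \<Rightarrow> real) \<Rightarrow> (real \<Rightarrow> real) \<Rightarrow> real" where
  "inner w f g = (\<integral>t. f t * g t / w t \<partial>M)"

lemma envelope_nonneg: "0 \<le> envelope t" by (auto simp: envelope_def intro: sum_nonneg)

lemma integrable_envelope: "integrable M envelope"
  unfolding envelope_def using integrable_v by (intro Bochner_Integration.integrable_sum integrable_abs) auto

lemma weight_envelope: "weight envelope"
  using integrable_envelope by (auto simp: weight_def intro!: exI[of _ 1])

lemma weight_nonneg: "weight w \<Longrightarrow> 0 \<le> w t"
proof -
  assume "weight w"
  then obtain \<alpha> where "0 < \<alpha>" "envelope t \<le> \<alpha> * w t" by (auto simp: weight_def)
  then have "0 \<le> \<alpha> * w t" using envelope_nonneg[of t] by linarith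
  then show ?thesis using \<open>0 < \<alpha>\<close> by (simp add: zero_le_mult_iff)
qed

lemma weight_pos: "weight w \<Longrightarrow> envelope t \<noteq> 0 \<Longrightarrow> 0 < w t"
proof -
  assume "weight w" "envelope t \<noteq> 0"
  then obtain \<alpha> where "0 < \<alpha>" "envelope t \<le> \<alpha> * w t" by (auto simp: weight_def)
  then have "0 < \<alpha> * w t" using envelope_nonneg[of t] \<open>envelope t \<noteq> 0\<close> by linarith
  then show ?thesis using \<open>0 < \<alpha>\<close> by (simp add: zero_less_mult_iff)
qed

lemma weight_integrable: "weight w \<Longrightarrow> integrable M w"
proof -
  assume w: "weight w"
  then obtain \<alpha> where "\<And>t. w t \<le> \<alpha> * envelope t" "w \<in> borel_measurable M" by (auto simp: weight_def)
  then show ?thesis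
    using weight_nonneg[OF w] integrable_envelope
    by (intro Bochner_Integration.integrable_bound[of M "\<lambda>t. \<alpha> * envelope t" w]) (auto intro!: always_eventually intro: order_trans[OF _ abs_ge_self])
qed

lemma comb_bound:
  assumes "f \<in> lin_comb v n"
  obtains C where "0 \<le> C" "\<And>t. \<bar>f t\<bar> \<le> C * envelope t"
proof -
  obtain c where f: "f = (\<lambda>t. \<Sum>j<n. c j * v j t)" using assms by (auto simp: lin_comb_def)
  define C where "C = (\<Sum>j<n. \<bar>c j\<bar>)"
  have "\<bar>f t\<bar> \<le> C * envelope t" for t
  proof -
    have "\<bar>f t\<bar> \<le> (\<Sum>j<n. \<bar>c j\<bar> * \<bar>v j t\<bar>)"
      unfolding f by (rule order_trans[OF sum_abs]) (simp add: abs_mult)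
    also have "\<dots> \<le> (\<Sum>j<n. C * \<bar>v j t\<bar>)"
      unfolding C_def by (intro sum_mono mult_right_mono member_le_sum) auto
    also have "\<dots> = C * envelope t" by (simp add: envelope_def sum_distrib_left)
    finally show ?thesis .
  qed
  moreover have "0 \<le> C" by (auto simp: C_def intro: sum_nonneg)
  ultimately show thesis by (rule that[rotated])
qed

lemma comb_zero: "f \<in> lin_comb v n \<Longrightarrow> envelope t = 0 \<Longrightarrow> f t = 0"
  by (metis comb_bound abs_le_zero_iff mult_zero_right)

lemma comb_measurable: "f \<in> lin_comb v n \<Longrightarrow> f \<in> borel_measurable M"
  unfolding lin_comb_def using integrable_v by (auto intro!: borel_measurable_sum borel_measurable_times)

lemma inner_integrable:
  assumes w: "weight w" and f: "f \<in> lin_comb v n" and g: "g \<in> lin_comb v n"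
  shows "integrable M (\<lambda>t. f t * g t / w t)"
proof -
  obtain C where C: "0 \<le> C" "\<And>t. \<bar>f t\<bar> \<le> C * envelope t" using comb_bound[OF f] by blast
  obtain D where D: "0 \<le> D" "\<And>t. \<bar>g t\<bar> \<le> D * envelope t" using comb_bound[OF g] by blast
  obtain \<alpha> where \<alpha>: "0 < \<alpha>" "\<And>t. envelope t \<le> \<alpha> * w t" using w by (auto simp: weight_def)
  have "norm (f t * g t / w t) \<le> norm (C * D * \<alpha> * envelope t)" for t
  proof (cases "envelope t = 0")
    case True then show ?thesis using comb_zero f by simp
  next
    case False
    have wp: "0 < w t" by (rule weight_pos[OF w False])
    have "\<bar>f t * g t\<bar> \<le> (C * envelope t) * (D * envelope t)"
      unfolding abs_mult using C D envelope_nonneg by (intro mult_mono) auto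
    also have "\<dots> = C * D * envelope t * envelope t" by simp
    also have "\<dots> \<le> C * D * envelope t * (\<alpha> * w t)"
      using \<alpha> C D envelope_nonneg by (intro mult_left_mono) auto
    finally show ?thesis using wp C D \<alpha> envelope_nonneg[of t] by (simp add: abs_mult divide_le_eq algebra_simps)
  qed
  note bound = this
  have [measurable]: "f \<in> borel_measurable M" "g \<in> borel_measurable M" "w \<in> borel_measurable M"
    using comb_measurable[OF f] comb_measurable[OF g] w by (auto simp: weight_def)
  show ?thesis
  proof (rule Bochner_Integration.integrable_bound)
    show "integrable M (\<lambda>t. C * D * \<alpha> * envelope t)" using integrable_envelope by simp
    show "AE t in M. norm (f t * g t / w t) \<le> norm (C * D * \<alpha> * envelope t)"
      using bound by (intro always_eventually allI)
  qed measurable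
qed

lemma inner_commute: "inner w f g = inner w g f"
  by (simp add: inner_def mult.commute)

lemma inner_add_left:
  "weight w \<Longrightarrow> f \<in> lin_comb v n \<Longrightarrow> f' \<in> lin_comb v n \<Longrightarrow> g \<in> lin_comb v n \<Longrightarrow>
   inner w (\<lambda>t. f t + f' t) g = inner w f g + inner w f' g"
  unfolding inner_def by (subst Bochner_Integration.integral_add[symmetric])
    (auto simp: inner_integrable distrib_right add_divide_distrib)

lemma inner_scale_left: "inner w (\<lambda>t. c * f t) g = c * inner w f g"
  unfolding inner_def by (subst integral_mult_right_zero[symmetric]) (simp add: mult.assoc)

lemma inner_sum_left:
  assumes "weight w" "g \<in> lin_comb v n"
  shows "(\<And>i. i < (m::nat) \<Longrightarrow> f i \<in> lin_comb v n) \<Longrightarrow>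
   inner w (\<lambda>t. \<Sum>i<m. c i * f i t) g = (\<Sum>i<m. c i * inner w (f i) g)"
proof (induction m)
  case 0 show ?case by (simp add: inner_def)
next
  case (Suc m)
  then show ?case
    using assms by (simp add: inner_add_left lin_comb_sum lin_comb_scale inner_scale_left)
qed

lemma inner_self_nonneg: "weight w \<Longrightarrow> 0 \<le> inner w f f"
  unfolding inner_def by (intro integral_nonneg_AE always_eventually allI divide_nonneg_nonneg) (auto simp: weight_nonneg)

lemma inner_self_zero:
  assumes w: "weight w" and f: "f \<in> lin_comb v n" and z: "inner w f f = 0"
  shows "AE t in M. f t = 0"
proof -
  have "AE t in M. f t * f t / w t = 0"
    using z inner_integrable[OF w f f] weight_nonneg[OF w]
    unfolding inner_def by (subst (asm) integral_nonneg_eq_0_iff_AE) auto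
  then show ?thesis
  proof eventually_elim
    case (elim t)
    then show ?case using weight_pos[OF w, of t] comb_zero[OF f, of t] by force
  qed
qed

definition orthonormal :: "(real \<Rightarrow> real) \<Rightarrow> (nat \<Rightarrow> real \<Rightarrow> real) \<Rightarrow> nat \<Rightarrow> bool" where
  "orthonormal w y k \<longleftrightarrow>
     (\<forall>i<k. \<forall>j<k. inner w (y i) (y j) = (if i = j then 1 else 0)) \<and> lin_comb y k = lin_comb v k"

text \<open>Gram-Schmidt. The residual \<open>e\<close> cannot have norm 0: it would vanish almost
  everywhere, and \<open>v k\<close> would agree almost everywhere with a combination of its
  predecessors.\<close>

lemma orthonormal_exists:
  assumes w: "weight w"
  shows "k \<le> n \<Longrightarrow> \<exists>y. orthonormal w y k"
proof (induction k)
  case 0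
  then show ?case by (auto simp: orthonormal_def lin_comb_def)
next
  case (Suc k)
  then obtain y where on: "\<And>i j. i < k \<Longrightarrow> j < k \<Longrightarrow> inner w (y i) (y j) = (if i = j then 1 else 0)"
    and sp: "lin_comb y k = lin_comb v k" by (auto simp: orthonormal_def)
  have sub: "lin_comb v k \<subseteq> lin_comb v (Suc k)" "lin_comb v (Suc k) \<subseteq> lin_comb v n"
    using Suc.prems by (auto intro!: lin_comb_mono)
  have yk: "y i \<in> lin_comb v k" if "i < k" for i using lin_comb_base[OF that, of y] sp by simp
  have yn: "y i \<in> lin_comb v n" if "i < k" for i using yk that sub by blast
  have vn: "v k \<in> lin_comb v n" using Suc.prems by (intro lin_comb_base) auto
  define p where "p = (\<lambda>t. \<Sum>i<k. inner w (v k) (y i) * y i t)"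
  define e where "e = (\<lambda>t. v k t + (-1) * p t)"
  have p: "p \<in> lin_comb v k" unfolding p_def by (intro lin_comb_sum yk)
  have pn: "p \<in> lin_comb v n" using p sub by blast
  have eS: "e \<in> lin_comb v (Suc k)"
    unfolding e_def using p sub by (intro lin_comb_add lin_comb_scale lin_comb_base) auto
  have en: "e \<in> lin_comb v n" using eS sub by blast
  have ey: "inner w e (y j) = 0" if j: "j < k" for j
  proof -
    have "inner w p (y j) = (\<Sum>i<k. inner w (v k) (y i) * inner w (y i) (y j))"
      unfolding p_def by (rule inner_sum_left[OF w yn[OF j]]) (rule yn)
    also have "\<dots> = (\<Sum>i<k. if i = j then inner w (v k) (y j) else 0)"
      using j on by (intro sum.cong) auto
    also have "\<dots> = inner w (v k) (y j)" using j by simp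
    finally have py: "inner w p (y j) = inner w (v k) (y j)" .
    have "inner w e (y j) = inner w (v k) (y j) + inner w (\<lambda>t. (-1) * p t) (y j)"
      unfolding e_def by (rule inner_add_left[OF w vn lin_comb_scale[OF pn] yn[OF j]])
    also have "\<dots> = 0" unfolding inner_scale_left py by simp
    finally show ?thesis .
  qed
  define q where "q = inner w e e"
  have q: "0 < q"
  proof -
    have "q \<noteq> 0"
    proof
      assume "q = 0"
      then have "AE t in M. e t = 0" using inner_self_zero[OF w en] by (simp add: q_def)
      then have "AE t in M. v k t = p t" by eventually_elim (simp add: e_def)
      moreover have "k < n" using Suc.prems by simp
      ultimately show False using indep p by blast
    qed
    then show ?thesis using inner_self_nonneg[OF w, of e] by (simp add: q_def)
  qed
  define z where "z = (\<lambda>i. if i < k then y i else (\<lambda>t. (1 / sqrt q) * e t))"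
  have zz: "inner w (z i) (z j) = (if i = j then 1 else 0)" if ij: "i < Suc k" "j < Suc k" for i j
  proof -
    have scr: "inner w f (\<lambda>t. c * g t) = c * inner w f g" for f g c
      by (subst inner_commute) (simp add: inner_scale_left inner_commute)
    have zk: "z k = (\<lambda>t. (1 / sqrt q) * e t)" by (simp add: z_def)
    have qq: "q = sqrt q * sqrt q" using q by simp
    consider "i < k" "j < k" | "i < k" "j = k" | "i = k" "j < k" | "i = k" "j = k" using ij by linarith
    then show ?thesis
    proof cases
      case 1 then show ?thesis using on by (simp add: z_def)
    next
      case 2
      then have "inner w (z i) (z j) = (1 / sqrt q) * inner w (y i) e"
        using zk by (simp only: scr) (simp add: z_def)
      then show ?thesis using 2 ey[of i] by (simp add: inner_commute[of w "y i"])
    next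
      case 3
      then have "inner w (z i) (z j) = (1 / sqrt q) * inner w e (y j)"
        using zk by (simp only: inner_scale_left) (simp add: z_def)
      then show ?thesis using 3 ey[of j] by simp
    next
      case 4
      then have "inner w (z i) (z j) = (1 / sqrt q) * ((1 / sqrt q) * q)"
        using zk by (simp only: inner_scale_left scr q_def)
      then show ?thesis using q 4 qq by (simp add: field_simps)
    qed
  qed
  have zS: "z i \<in> lin_comb v (Suc k)" if "i < Suc k" for i
    using that yk sub lin_comb_scale[OF eS, of "1 / sqrt q"] by (auto simp: z_def)
  have "lin_comb z (Suc k) \<subseteq> lin_comb v (Suc k)"
  proof
    fix f assume "f \<in> lin_comb z (Suc k)"
    then obtain c where "f = (\<lambda>t. \<Sum>j<Suc k. c j * z j t)" by (auto simp: lin_comb_def)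
    then show "f \<in> lin_comb v (Suc k)" using lin_comb_sum[of "Suc k" z v "Suc k" c] zS by simp
  qed
  moreover have "lin_comb v (Suc k) \<subseteq> lin_comb z (Suc k)"
  proof -
    have yz: "lin_comb y k \<subseteq> lin_comb z (Suc k)"
    proof -
      have "lin_comb y k = lin_comb z k" by (simp add: lin_comb_def z_def)
      then show ?thesis using lin_comb_mono[of k "Suc k" z] by simp
    qed
    have "v j \<in> lin_comb z (Suc k)" if j: "j < Suc k" for j
    proof (cases "j < k")
      case True
      then show ?thesis using lin_comb_base[of j k v] sp yz by auto
    next
      case False
      then have jk: "j = k" using j by simp
      have "v k = (\<lambda>t. p t + sqrt q * z k t)" using q by (simp add: z_def e_def fun_eq_iff)
      also have "\<dots> \<in> lin_comb z (Suc k)"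
        using p sp yz by (intro lin_comb_add lin_comb_scale lin_comb_base) auto
      finally show ?thesis using jk by simp
    qed
    then have vz: "\<And>j. j < Suc k \<Longrightarrow> v j \<in> lin_comb z (Suc k)" .
    show ?thesis
    proof
      fix f assume "f \<in> lin_comb v (Suc k)"
      then obtain c where "f = (\<lambda>t. \<Sum>j<Suc k. c j * v j t)" by (auto simp: lin_comb_def)
      then show "f \<in> lin_comb z (Suc k)" using lin_comb_sum[of "Suc k" v z "Suc k" c] vz by simp
    qed
  qed
  ultimately show ?case using zz unfolding orthonormal_def by (intro exI[of _ z]) blast
qed

text \<open>For an orthonormal \<open>y\<close>, this is the diagonal of the reproducing kernel of
  the span: the largest value of \<open>(f t)^2\<close> among \<open>f\<close> with
  \<open>inner w f f \<le> 1\<close>. As such it depends on \<open>w\<close> but not on the choice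
  of \<open>y\<close>.\<close>

definition kernel :: "(nat \<Rightarrow> real \<Rightarrow> real) \<Rightarrow> real \<Rightarrow> real" where
  "kernel y t = (\<Sum>i<n. (y i t)\<^sup>2)"

lemma kernel_nonneg: "0 \<le> kernel y t" by (simp add: kernel_def sum_nonneg)

lemma orthonormal_inner_comb:
  assumes w: "weight w" and y: "orthonormal w y n"
  shows "inner w (\<lambda>t. \<Sum>i<n. c i * y i t) (\<lambda>t. \<Sum>i<n. c i * y i t) = (\<Sum>i<n. (c i)\<^sup>2)"
proof -
  let ?f = "\<lambda>t. \<Sum>i<n. c i * y i t"
  have yn: "y i \<in> lin_comb v n" if "i < n" for i
    using y lin_comb_base[OF that, of y] by (simp add: orthonormal_def)
  have f: "?f \<in> lin_comb v n" by (intro lin_comb_sum yn)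
  have yf: "inner w (y i) ?f = c i" if i: "i < n" for i
  proof -
    have "inner w (y i) ?f = inner w ?f (y i)" by (rule inner_commute)
    also have "\<dots> = (\<Sum>j<n. c j * inner w (y j) (y i))"
      by (rule inner_sum_left[OF w yn[OF i]]) (rule yn)
    also have "\<dots> = (\<Sum>j<n. if j = i then c i else 0)"
      using y i by (intro sum.cong) (auto simp: orthonormal_def)
    finally show ?thesis using i by simp
  qed
  have "inner w ?f ?f = (\<Sum>i<n. c i * inner w (y i) ?f)"
    by (rule inner_sum_left[OF w f]) (rule yn)
  also have "\<dots> = (\<Sum>i<n. (c i)\<^sup>2)" using yf by (intro sum.cong) (auto simp: power2_eq_square)
  finally show ?thesis .
qed

lemma square_le_kernel:
  assumes w: "weight w" and y: "orthonormal w y n" and f: "f \<in> lin_comb v n"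
  shows "(f t)\<^sup>2 \<le> kernel y t * inner w f f"
proof -
  obtain c where c: "f = (\<lambda>t. \<Sum>i<n. c i * y i t)"
    using f y unfolding orthonormal_def lin_comb_def by blast
  have "(f t)\<^sup>2 \<le> (\<Sum>i<n. (c i)\<^sup>2) * kernel y t"
    unfolding c kernel_def by (rule Cauchy_Schwarz_ineq_sum)
  also have "(\<Sum>i<n. (c i)\<^sup>2) = inner w f f"
    unfolding c by (rule orthonormal_inner_comb[OF w y, symmetric])
  finally show ?thesis by (simp add: mult.commute)
qed

text \<open>Keeps the iteration inside the weights: the upper bound holds since each
  \<open>y i\<close> is dominated by the envelope, the lower one since
  \<open>square_le_kernel\<close> applies to each \<open>v i\<close>.\<close>

lemma weight_sqrt_kernel:
  assumes w: "weight w" and y: "orthonormal w y n"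
  shows "weight (\<lambda>t. sqrt (kernel y t))"
proof -
  have yn: "y i \<in> lin_comb v n" if "i < n" for i
    using y lin_comb_base[OF that, of y] by (simp add: orthonormal_def)
  have "\<exists>C. 0 \<le> C \<and> (\<forall>t. \<bar>y i t\<bar> \<le> C * envelope t)" if "i < n" for i
    by (rule comb_bound[OF yn[OF that]]) (intro exI conjI allI)
  then obtain C where C: "\<And>i. i < n \<Longrightarrow> 0 \<le> C i" "\<And>i t. i < n \<Longrightarrow> \<bar>y i t\<bar> \<le> C i * envelope t"
    by metis
  define A where "A = (\<Sum>i<n. C i)"
  define B where "B = (\<Sum>i<n. sqrt (inner w (v i) (v i)))"
  have A0: "0 \<le> A" using C by (auto simp: A_def intro: sum_nonneg)
  have B0: "0 \<le> B" using inner_self_nonneg[OF w] by (auto simp: B_def intro: sum_nonneg)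
  have up: "sqrt (kernel y t) \<le> A * envelope t" for t
  proof -
    have "sqrt (kernel y t) \<le> (\<Sum>i<n. \<bar>y i t\<bar>)"
      using L2_set_le_sum_abs[of "\<lambda>i. y i t" "{..<n}"] by (simp add: L2_set_def kernel_def)
    also have "\<dots> \<le> (\<Sum>i<n. C i * envelope t)" using C by (intro sum_mono) auto
    finally show ?thesis by (simp add: A_def sum_distrib_right)
  qed
  have lo: "envelope t \<le> B * sqrt (kernel y t)" for t
  proof -
    have "\<bar>v i t\<bar> \<le> sqrt (inner w (v i) (v i)) * sqrt (kernel y t)" if "i < n" for i
      using real_sqrt_le_mono[OF square_le_kernel[OF w y lin_comb_base[OF that], of t]]
      by (simp add: real_sqrt_mult mult.commute)
    then show ?thesis unfolding envelope_def B_def sum_distrib_right by (intro sum_mono) auto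
  qed
  have "sqrt (kernel y t) \<le> (A + B + 1) * envelope t" for t
    by (rule order_trans[OF up]) (intro mult_right_mono envelope_nonneg, use B0 in simp)
  moreover have "envelope t \<le> (A + B + 1) * sqrt (kernel y t)" for t
    by (rule order_trans[OF lo]) (intro mult_right_mono, use A0 kernel_nonneg in auto)
  moreover have "(\<lambda>t. sqrt (kernel y t)) \<in> borel_measurable M"
    unfolding kernel_def using yn comb_measurable by (auto intro!: measurable_compose[OF _ borel_measurable_sqrt] borel_measurable_sum borel_measurable_power)
  ultimately show ?thesis using A0 B0 unfolding weight_def by (intro conjI exI[of _ "A + B + 1"]) auto
qed

text \<open>The trace identity: the integral is the sum of the squared norms of \<open>n\<close>
  orthonormal functions.\<close>

lemma kernel_integral:
  assumes w: "weight w" and y: "orthonormal w y n"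
  shows "integrable M (\<lambda>t. kernel y t / w t)" "(\<integral>t. kernel y t / w t \<partial>M) = n"
proof -
  have yn: "y i \<in> lin_comb v n" if "i < n" for i
    using y lin_comb_base[OF that, of y] by (simp add: orthonormal_def)
  have eq: "kernel y t / w t = (\<Sum>i<n. y i t * y i t / w t)" for t
    by (simp add: kernel_def sum_divide_distrib power2_eq_square)
  have int: "\<And>i. i \<in> {..<n} \<Longrightarrow> integrable M (\<lambda>t. y i t * y i t / w t)"
    using inner_integrable[OF w] yn by simp
  show "integrable M (\<lambda>t. kernel y t / w t)"
    unfolding eq using int by (rule Bochner_Integration.integrable_sum)
  have "(\<integral>t. kernel y t / w t \<partial>M) = (\<Sum>i<n. inner w (y i) (y i))"
    unfolding eq inner_def using int by (rule Bochner_Integration.integral_sum)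
  also have "\<dots> = n" using y by (simp add: orthonormal_def)
  finally show "(\<integral>t. kernel y t / w t \<partial>M) = n" .
qed

text \<open>A larger weight means a smaller quadratic form, hence a larger unit ball and a larger
  extremal value.\<close>

lemma kernel_le:
  assumes w: "weight w" "orthonormal w y n" and w': "weight w'" "orthonormal w' y' n"
    and le: "\<And>t. w t \<le> \<alpha> * w' t" and \<alpha>: "0 < \<alpha>"
  shows "kernel y t \<le> \<alpha> * kernel y' t"
proof (cases "kernel y t = 0")
  case True
  have "0 \<le> \<alpha> * kernel y' t" by (intro mult_nonneg_nonneg kernel_nonneg less_imp_le[OF \<alpha>])
  with True show ?thesis by (simp only:)
next
  case False
  \<comment> \<open>The reproducing element at \<open>t\<close> for \<open>w\<close>: its value at
    \<open>t\<close> and its squared norm both equal \<open>kernel y t\<close>, so it is extremal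
    for \<open>w\<close> and is tested against \<open>w'\<close>.\<close>
  define f where "f = (\<lambda>s. \<Sum>i<n. y i t * y i s)"
  have "f \<in> lin_comb y n" unfolding f_def by (rule lin_combI)
  then have f: "f \<in> lin_comb v n" using w(2) by (simp add: orthonormal_def)
  have ft: "f t = kernel y t" by (simp add: f_def kernel_def power2_eq_square)
  have fi: "inner w f f = kernel y t"
    unfolding f_def using orthonormal_inner_comb[OF w, of "\<lambda>i. y i t"] by (simp add: kernel_def)
  have "inner w' f f \<le> \<alpha> * inner w f f"
    unfolding inner_def integral_mult_right_zero[symmetric]
  proof (rule integral_mono)
    fix s
    show "f s * f s / w' s \<le> \<alpha> * (f s * f s / w s)"
    proof (cases "envelope s = 0")
      case True then show ?thesis using comb_zero[OF f] by simp
    next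
      case False
      have "0 < w s" "0 < w' s" using weight_pos False w w' by auto
      then have "f s * f s * w s \<le> f s * f s * (\<alpha> * w' s)"
        by (intro mult_left_mono le) auto
      then show ?thesis using \<open>0 < w s\<close> \<open>0 < w' s\<close> by (simp add: field_simps)
    qed
  qed (rule inner_integrable[OF w'(1) f f] integrable_mult_right[OF inner_integrable[OF w(1) f f]])+
  then have "kernel y' t * inner w' f f \<le> kernel y' t * (\<alpha> * kernel y t)"
    using fi kernel_nonneg by (intro mult_left_mono) auto
  with square_le_kernel[OF w' f, of t] have "(kernel y t)\<^sup>2 \<le> kernel y' t * (\<alpha> * kernel y t)"
    by (simp add: ft)
  then have "kernel y t * kernel y t \<le> (\<alpha> * kernel y' t) * kernel y t"
    by (simp add: power2_eq_square mult_ac)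
  then show ?thesis using False kernel_nonneg[of y t] by simp
qed

text \<open>
  By \<open>kernel_le\<close>, the map taking a weight \<open>w\<close> to the square root of its kernel halves distances
  measured by the supremum of \<open>\<bar>ln (w / w')\<bar>\<close>. A fixed point would be a Lewis weight;
  finitely many iterations give one up to a factor of 2, which is enough.
\<close>

definition balanced :: "real \<Rightarrow> bool" where
  "balanced \<alpha> \<longleftrightarrow> (\<exists>w y. weight w \<and> orthonormal w y n \<and>
     (\<forall>t. w t \<le> \<alpha> * sqrt (kernel y t) \<and> sqrt (kernel y t) \<le> \<alpha> * w t))"

lemma balanced_sqrt:
  assumes "balanced \<alpha>" "0 < \<alpha>"
  shows "balanced (sqrt \<alpha>)"
proof -
  obtain w y where w: "weight w" "orthonormal w y n"
    and b: "\<And>t. w t \<le> \<alpha> * sqrt (kernel y t)" "\<And>t. sqrt (kernel y t) \<le> \<alpha> * w t"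
    using assms(1) by (auto simp: balanced_def)
  let ?w = "\<lambda>t. sqrt (kernel y t)"
  have w': "weight ?w" by (rule weight_sqrt_kernel[OF w])
  obtain z where z: "orthonormal ?w z n" using orthonormal_exists[OF w'] by blast
  have "kernel y t \<le> \<alpha> * kernel z t" for t by (rule kernel_le[OF w w' z b(1) assms(2)])
  then have "sqrt (kernel y t) \<le> sqrt \<alpha> * sqrt (kernel z t)" for t
    by (metis real_sqrt_le_mono real_sqrt_mult)
  moreover have "kernel z t \<le> \<alpha> * kernel y t" for t by (rule kernel_le[OF w' z w b(2) assms(2)])
  then have "sqrt (kernel z t) \<le> sqrt \<alpha> * sqrt (kernel y t)" for t
    by (metis real_sqrt_le_mono real_sqrt_mult)
  ultimately show ?thesis using w' z unfolding balanced_def by blast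
qed

lemma balanced_mono:
  assumes "balanced \<alpha>" "\<alpha> \<le> \<beta>"
  shows "balanced \<beta>"
proof -
  obtain w y where w: "weight w" "orthonormal w y n"
    and b: "\<And>t. w t \<le> \<alpha> * sqrt (kernel y t)" "\<And>t. sqrt (kernel y t) \<le> \<alpha> * w t"
    using assms(1) by (auto simp: balanced_def)
  have "w t \<le> \<beta> * sqrt (kernel y t)" for t
    by (rule order_trans[OF b(1)]) (intro mult_right_mono assms(2), simp add: kernel_nonneg)
  moreover have "sqrt (kernel y t) \<le> \<beta> * w t" for t
    by (rule order_trans[OF b(2)]) (intro mult_right_mono assms(2) weight_nonneg w)
  ultimately show ?thesis using w unfolding balanced_def by blast
qed

lemma balanced_2: "balanced 2"
proof -
  obtain y where y: "orthonormal envelope y n" using orthonormal_exists[OF weight_envelope] by blast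
  obtain \<alpha> where "0 < \<alpha>" "\<And>t. envelope t \<le> \<alpha> * sqrt (kernel y t)" "\<And>t. sqrt (kernel y t) \<le> \<alpha> * envelope t"
    using weight_sqrt_kernel[OF weight_envelope y] by (auto simp: weight_def)
  then have b: "balanced \<alpha>" using weight_envelope y unfolding balanced_def by blast
  \<comment> \<open>Each iteration takes a square root of the ratio, so \<open>2 ^ (2 ^ k)\<close>
    comes down to 2 after \<open>k\<close> steps.\<close>
  obtain k :: nat where k: "\<alpha> < real k" using reals_Archimedean2 by blast
  have "k < 2 ^ k" by (rule less_exp)
  also have "(2::nat) ^ k \<le> 2 ^ (2 ^ k)" by (intro power_increasing less_imp_le[OF less_exp]) auto
  finally have "real k < 2 ^ (2 ^ k)" by (metis of_nat_less_iff of_nat_numeral of_nat_power)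
  then have "balanced (2 ^ (2 ^ k))" using k by (intro balanced_mono[OF b]) linarith
  then show ?thesis
  proof (induction k)
    case (Suc k)
    have "sqrt (2 ^ (2 ^ Suc k)) = (2::real) ^ (2 ^ k)"
      by (intro real_sqrt_unique) (auto simp: power_mult[symmetric] mult.commute)
    then show ?case using Suc balanced_sqrt[of "2 ^ (2 ^ Suc k)"] by simp
  qed simp
qed

text \<open>For an exact Lewis weight, \<open>w^2\<close> is the kernel and the trace identity gives
  \<open>w\<close> integral \<open>n\<close>. By Cauchy-Schwarz the L_1 norm of \<open>f\<close> is
  then at most \<open>sqrt n\<close> times its weighted norm, so dividing the orthonormal system by
  \<open>sqrt n\<close> would do. Balance up to a factor of 2 only worsens the constants:
  \<open>w\<close> has integral at most \<open>4 * n\<close>, the root of the kernel at least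
  \<open>n / 2\<close>.\<close>

lemma exists_spread_system:
  "\<exists>y. (\<forall>i<n. y i \<in> lin_comb v n) \<and>
    (\<forall>u. (\<Sum>i<n. (u i)\<^sup>2) \<le> 1 \<longrightarrow> (\<integral>t. \<bar>\<Sum>i<n. u i * y i t\<bar> \<partial>M) \<le> 1) \<and>
    integrable M (\<lambda>t. sqrt (\<Sum>i<n. (y i t)\<^sup>2)) \<and>
    sqrt n / 4 \<le> (\<integral>t. sqrt (\<Sum>i<n. (y i t)\<^sup>2) \<partial>M)"
proof (cases "n = 0")
  case True
  then show ?thesis by simp
next
  case False
  obtain w y where w: "weight w" "orthonormal w y n"
    and b: "\<And>t. w t \<le> 2 * sqrt (kernel y t)" "\<And>t. sqrt (kernel y t) \<le> 2 * w t"
    using balanced_2 by (auto simp: balanced_def)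
  have yn: "y i \<in> lin_comb v n" if "i < n" for i
    using w(2) lin_comb_base[OF that, of y] by (simp add: orthonormal_def)
  note wint = weight_integrable[OF w(1)]
  note kint = weight_integrable[OF weight_sqrt_kernel[OF w]]
  \<comment> \<open>Where \<open>w\<close> vanishes, \<open>kernel y t / w t\<close> has the default
    value 0; the kernel vanishes there too, so the pointwise comparisons survive.\<close>
  have k0: "kernel y t = 0" if "w t = 0" for t using b(2)[of t] kernel_nonneg[of y t] that by simp
  have wn: "0 \<le> w t" for t by (rule weight_nonneg[OF w(1)])
  have ksq: "sqrt (kernel y t) * sqrt (kernel y t) = kernel y t" for t using kernel_nonneg by simp
  have "(\<integral>t. w t \<partial>M) \<le> (\<integral>t. 4 * (kernel y t / w t) \<partial>M)"
  proof (rule integral_mono[OF wint integrable_mult_right[OF kernel_integral(1)[OF w]]])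
    fix t
    have "w t * w t \<le> (2 * sqrt (kernel y t)) * (2 * sqrt (kernel y t))"
      using b wn by (intro mult_mono) (auto simp: kernel_nonneg)
    then show "w t \<le> 4 * (kernel y t / w t)"
      using wn[of t] ksq[of t] by (cases "w t = 0") (auto simp: field_simps)
  qed
  then have Iw: "(\<integral>t. w t \<partial>M) \<le> 4 * n"
    by (simp only: integral_mult_right_zero kernel_integral(2)[OF w])
  have "(\<integral>t. kernel y t / w t \<partial>M) \<le> (\<integral>t. 2 * sqrt (kernel y t) \<partial>M)"
  proof (rule integral_mono)
    fix t
    have "sqrt (kernel y t) * sqrt (kernel y t) \<le> sqrt (kernel y t) * (2 * w t)"
      using b by (intro mult_left_mono) (auto simp: kernel_nonneg)
    then show "kernel y t / w t \<le> 2 * sqrt (kernel y t)"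
      using wn[of t] ksq[of t] k0[of t] by (cases "w t = 0") (auto simp: field_simps)
  qed (use kernel_integral[OF w] kint in auto)
  then have Ik: "n / 2 \<le> (\<integral>t. sqrt (kernel y t) \<partial>M)" using kernel_integral[OF w] by simp
  \<comment> \<open>Chosen so that \<open>s * s\<close> is the bound \<open>4 * n\<close> on the
    integral of \<open>w\<close>.\<close>
  define s where "s = 2 * sqrt n"
  have s: "0 < s" "s * s = 4 * n" using False by (auto simp: s_def)
  define z where "z = (\<lambda>i t. (1/s) * y i t)"
  have sz: "sqrt (\<Sum>i<n. (z i t)\<^sup>2) = (1/s) * sqrt (kernel y t)" for t
  proof -
    have "(\<Sum>i<n. (z i t)\<^sup>2) = (1/s)\<^sup>2 * kernel y t"
      by (simp only: z_def kernel_def power_mult_distrib sum_distrib_left)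
    then show ?thesis using s by (simp only: real_sqrt_mult real_sqrt_abs) simp
  qed
  show ?thesis
  proof (intro exI[of _ z] conjI allI impI)
    show "z i \<in> lin_comb v n" if "i < n" for i unfolding z_def by (intro lin_comb_scale yn that)
    show "integrable M (\<lambda>t. sqrt (\<Sum>i<n. (z i t)\<^sup>2))" unfolding sz using kint by simp
    have "sqrt n / 4 = (1/s) * (n / 2)"
      using s by (simp add: s_def field_simps)
    also have "\<dots> \<le> (1/s) * (\<integral>t. sqrt (kernel y t) \<partial>M)" using s Ik by (intro mult_left_mono) auto
    also have "\<dots> = (\<integral>t. sqrt (\<Sum>i<n. (z i t)\<^sup>2) \<partial>M)" unfolding sz by simp
    finally show "sqrt n / 4 \<le> (\<integral>t. sqrt (\<Sum>i<n. (z i t)\<^sup>2) \<partial>M)" .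
    fix u :: "nat \<Rightarrow> real" assume u: "(\<Sum>i<n. (u i)\<^sup>2) \<le> 1"
    define f where "f = (\<lambda>t. \<Sum>i<n. u i * y i t)"
    have f: "f \<in> lin_comb v n" unfolding f_def by (intro lin_comb_sum yn)
    have fi: "inner w f f = (\<Sum>i<n. (u i)\<^sup>2)" unfolding f_def by (rule orthonormal_inner_comb[OF w])
    have zf: "(\<Sum>i<n. u i * z i t) = f t / s" for t
      by (simp add: z_def f_def sum_divide_distrib)
    have "(\<integral>t. \<bar>\<Sum>i<n. u i * z i t\<bar> \<partial>M) \<le> (\<integral>t. (f t * f t / w t) / 2 + w t / (2 * (s * s)) \<partial>M)"
    proof (rule integral_mono')
      show "integrable M (\<lambda>t. (f t * f t / w t) / 2 + w t / (2 * (s * s)))"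
        by (intro Bochner_Integration.integrable_add integrable_divide inner_integrable[OF w(1) f f] wint)
      fix t
      show "\<bar>\<Sum>i<n. u i * z i t\<bar> \<le> (f t * f t / w t) / 2 + w t / (2 * (s * s))"
      proof (cases "envelope t = 0")
        case True
        then show ?thesis using comb_zero[OF f] wn s unfolding zf by simp
      next
        case False
        have wp: "0 < w t" by (rule weight_pos[OF w(1) False])
        \<comment> \<open>Cauchy-Schwarz in its pointwise arithmetic-geometric form; after
          integration each of the two terms contributes at most 1/2.\<close>
        have "0 \<le> (\<bar>f t\<bar> / sqrt (w t) - sqrt (w t) / s)\<^sup>2" by simp
        also have "\<dots> = f t * f t / w t + w t / (s * s) - 2 * (\<bar>f t\<bar> / s)"
          using wp s by (simp add: power2_diff power_divide power2_eq_square[of s] power2_eq_square[of "f t"])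
        finally show ?thesis using s unfolding zf by (simp add: abs_divide)
      qed
      show "0 \<le> (f t * f t / w t) / 2 + w t / (2 * (s * s))" using wn[of t] s by simp
    qed
    also have "\<dots> = inner w f f / 2 + (\<integral>t. w t \<partial>M) / (2 * (s * s))"
      unfolding inner_def
      by (subst Bochner_Integration.integral_add)
        (intro integrable_divide inner_integrable[OF w(1) f f] wint | simp only: integral_divide_zero)+
    also have "\<dots> \<le> 1 / 2 + 1 / 2"
      using u fi Iw s False by (intro add_mono) (auto simp: divide_simps)
    finally show "(\<integral>t. \<bar>\<Sum>i<n. u i * z i t\<bar> \<partial>M) \<le> 1" by simp
  qed
qed

end

section \<open>A norming set of exponential size\<close>

lemma sum_half_power_abs_le: "(\<Sum>k\<in>{- int m..int m}. (1/2::real) ^ nat \<bar>k\<bar>) \<le> 3"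
proof -
  have "(\<Sum>k\<in>{- int m..int m}. (1/2::real) ^ nat \<bar>k\<bar>) = 3 - 2 * (1/2) ^ m"
  proof (induction m)
    case (Suc m)
    have "{- int (Suc m)..int (Suc m)} = insert (int (Suc m)) (insert (- int (Suc m)) {- int m..int m})"
      by auto
    then show ?case using Suc by (simp add: nat_add_distrib)
  qed simp
  then show ?thesis by simp
qed

text \<open>Rankin's trick: a lattice point in the ball of squared radius \<open>4 * n\<close> has weight at least
  \<open>2 ^ (- 4 * n)\<close>, while the total weight factorizes over the coordinates.\<close>

lemma card_lattice_ball:
  fixes n :: nat
  defines "K \<equiv> {k \<in> {..<n} \<rightarrow>\<^sub>E {- int (4 * n)..int (4 * n)}. (\<Sum>i<n. (k i)\<^sup>2) \<le> int (4 * n)}"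
  shows "real (card K) \<le> 48 ^ n" "finite K"
proof -
  let ?B = "{..<n} \<rightarrow>\<^sub>E {- int (4 * n)..int (4 * n)}"
  have fB: "finite ?B" by (intro finite_PiE) auto
  then show "finite K" unfolding K_def by (rule finite_subset[rotated]) auto
  have w: "(1/16::real) ^ n \<le> (\<Prod>i<n. (1/2) ^ nat \<bar>k i\<bar>)" if k: "k \<in> K" for k
  proof -
    have "(\<Sum>i<n. \<bar>k i\<bar>) \<le> (\<Sum>i<n. (k i)\<^sup>2)"
    proof (rule sum_mono)
      fix i
      show "\<bar>k i\<bar> \<le> (k i)\<^sup>2"
        using mult_left_mono[of 1 "\<bar>k i\<bar>" "\<bar>k i\<bar>"] by (cases "k i = 0") (auto simp: power2_eq_square)
    qed
    then have "(\<Sum>i<n. \<bar>k i\<bar>) \<le> int (4 * n)" using k by (auto simp: K_def)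
    then have "(\<Sum>i<n. nat \<bar>k i\<bar>) \<le> 4 * n"
      by (simp flip: of_nat_le_iff[where 'a = int])
    then have "(1/2::real) ^ (4 * n) \<le> (1/2) ^ (\<Sum>i<n. nat \<bar>k i\<bar>)" by (intro power_decreasing) auto
    also have "\<dots> = (\<Prod>i<n. (1/2) ^ nat \<bar>k i\<bar>)" by (rule power_sum)
    also have "(1/2::real) ^ (4 * n) = (1/16) ^ n" unfolding power_mult by (simp add: power_divide)
    finally show ?thesis .
  qed
  have "real (card K) * (1/16) ^ n = (\<Sum>k\<in>K. (1/16) ^ n)" by simp
  also have "\<dots> \<le> (\<Sum>k\<in>K. \<Prod>i<n. (1/2) ^ nat \<bar>k i\<bar>)" by (intro sum_mono w)
  also have "\<dots> \<le> (\<Sum>k\<in>?B. \<Prod>i<n. (1/2) ^ nat \<bar>k i\<bar>)"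
    by (intro sum_mono2 fB) (auto simp: K_def prod_nonneg)
  also have "\<dots> = (\<Prod>i<n. \<Sum>k\<in>{- int (4 * n)..int (4 * n)}. (1/2) ^ nat \<bar>k\<bar>)"
    by (rule prod_sum_PiE[symmetric]) auto
  also have "\<dots> \<le> (\<Prod>i<n. 3)" by (intro prod_mono conjI sum_nonneg sum_half_power_abs_le) auto
  \<comment> \<open>\<open>48 = 16 * 3\<close>: each coordinate costs \<open>2 ^ 4\<close> for the
    lower bound on the weights and at most 3 for the geometric sum.\<close>
  finally show "real (card K) \<le> 48 ^ n"
    by (simp add: power_divide divide_le_eq flip: power_mult_distrib)
qed

text \<open>The vectors are integer points in the ball of radius \<open>2 * sqrt n\<close>, scaled
  into the unit ball. A vector \<open>z\<close> is stretched to that radius and rounded towards 0.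
  Rounding shortens it and moves each coordinate by at most 1, which after rescaling loses at most
  the l_1 norm of \<open>z\<close> divided by \<open>2 * sqrt n\<close>, hence at most half its
  Euclidean norm.\<close>

lemma exists_norming_set:
  fixes n :: nat
  assumes n: "0 < n"
  obtains U :: "(nat \<Rightarrow> real) set" where "finite U" "real (card U) \<le> 48 ^ n"
    and "\<And>u. u \<in> U \<Longrightarrow> (\<Sum>i<n. (u i)\<^sup>2) \<le> 1"
    and "\<And>z. \<exists>u\<in>U. sqrt (\<Sum>i<n. (z i)\<^sup>2) / 2 \<le> (\<Sum>i<n. u i * z i)"
proof -
  define K where "K = {k \<in> {..<n} \<rightarrow>\<^sub>E {- int (4 * n)..int (4 * n)}. (\<Sum>i<n. (k i)\<^sup>2) \<le> int (4 * n)}"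
  define s where "s = 2 * sqrt n"
  have s: "0 < s" "s\<^sup>2 = 4 * n" using n by (auto simp: s_def power_mult_distrib)
  define U where "U = (\<lambda>k i. real_of_int (k i) / s) ` K"
  have fK: "finite K" and cK: "real (card K) \<le> 48 ^ n"
    using card_lattice_ball[of n] by (auto simp: K_def)
  have "card U \<le> card K" unfolding U_def by (rule card_image_le[OF fK])
  then have cU: "real (card U) \<le> 48 ^ n" using cK by linarith
  have norm_U: "(\<Sum>i<n. (u i)\<^sup>2) \<le> 1" if u: "u \<in> U" for u
  proof -
    obtain k where k: "k \<in> K" "u = (\<lambda>i. real_of_int (k i) / s)" using u by (auto simp: U_def)
    have "(\<Sum>i<n. (u i)\<^sup>2) = real_of_int (\<Sum>i<n. (k i)\<^sup>2) / s\<^sup>2"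
      unfolding k(2) by (simp add: power_divide sum_divide_distrib)
    also have "real_of_int (\<Sum>i<n. (k i)\<^sup>2) \<le> real_of_int (int (4 * n))"
      using k(1) unfolding K_def of_int_le_iff by auto
    finally have "(\<Sum>i<n. (u i)\<^sup>2) \<le> real_of_int (int (4 * n)) / s\<^sup>2"
      by (simp add: divide_right_mono)
    then show ?thesis using s n by simp
  qed
  have "\<exists>u\<in>U. sqrt (\<Sum>i<n. (z i)\<^sup>2) / 2 \<le> (\<Sum>i<n. u i * z i)" for z :: "nat \<Rightarrow> real"
  proof (cases "(\<Sum>i<n. (z i)\<^sup>2) = 0")
    case True
    \<comment> \<open>For \<open>z = 0\<close> any member of \<open>U\<close> works; the zero
      lattice point shows that there is one.\<close>
    have "restrict (\<lambda>_. 0) {..<n} \<in> K" by (auto simp: K_def)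
    then obtain u where u: "u \<in> U" by (auto simp: U_def)
    have "\<forall>i\<in>{..<n}. z i = 0" using True by (subst (asm) sum_nonneg_eq_0_iff) auto
    then show ?thesis using u True by (intro bexI[OF _ u]) simp
  next
    case False
    define r where "r = sqrt (\<Sum>i<n. (z i)\<^sup>2)"
    have r2: "r\<^sup>2 = (\<Sum>i<n. (z i)\<^sup>2)" by (simp add: r_def sum_nonneg)
    have r: "0 < r" using False by (simp add: r_def order_less_le sum_nonneg)
    define y where "y = (\<lambda>i. s * \<bar>z i\<bar> / r)"
    define k :: "nat \<Rightarrow> int" where
      "k = restrict (\<lambda>i. if 0 \<le> z i then \<lfloor>y i\<rfloor> else - \<lfloor>y i\<rfloor>) {..<n}"
    have y0: "0 \<le> y i" for i using s r by (simp add: y_def)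
    have fl: "0 \<le> \<lfloor>y i\<rfloor>" "real_of_int \<lfloor>y i\<rfloor> \<le> y i" "y i - 1 \<le> real_of_int \<lfloor>y i\<rfloor>" for i
      using y0[of i] by (simp, linarith, linarith)
    have sy: "(\<Sum>i<n. (y i)\<^sup>2) = 4 * n"
    proof -
      have "(\<Sum>i<n. (y i)\<^sup>2) = s\<^sup>2 / r\<^sup>2 * (\<Sum>i<n. (z i)\<^sup>2)"
        by (simp add: y_def power_mult_distrib power_divide sum_distrib_left)
      then show ?thesis using r s by (simp flip: r2)
    qed
    have k2: "(k i)\<^sup>2 = \<lfloor>y i\<rfloor>\<^sup>2" if "i < n" for i using that by (simp add: k_def)
    have ks: "(\<Sum>i<n. (k i)\<^sup>2) \<le> int (4 * n)"
    proof -
      have "real_of_int (\<Sum>i<n. (k i)\<^sup>2) = (\<Sum>i<n. (real_of_int \<lfloor>y i\<rfloor>)\<^sup>2)" using k2 by simp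
      also have "\<dots> \<le> (\<Sum>i<n. (y i)\<^sup>2)" using fl by (intro sum_mono power_mono) auto
      finally have "real_of_int (\<Sum>i<n. (k i)\<^sup>2) \<le> real_of_int (int (4 * n))" using sy by simp
      then show ?thesis unfolding of_int_le_iff .
    qed
    have kb: "\<bar>k i\<bar> \<le> int (4 * n)" if i: "i < n" for i
    proof -
      have "\<bar>k i\<bar> \<le> (k i)\<^sup>2"
        using mult_left_mono[of 1 "\<bar>k i\<bar>" "\<bar>k i\<bar>"] by (cases "k i = 0") (auto simp: power2_eq_square)
      also have "\<dots> \<le> (\<Sum>i<n. (k i)\<^sup>2)" using i by (intro member_le_sum) auto
      finally show ?thesis using ks by linarith
    qed
    have "k i \<in> {- int (4 * n)..int (4 * n)}" if "i < n" for i using kb[OF that] by auto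
    moreover have "k \<in> extensional {..<n}" by (simp add: k_def)
    ultimately have kK: "k \<in> K" using ks by (auto simp: K_def PiE_def)
    have "(\<Sum>i<n. \<bar>z i\<bar>)\<^sup>2 \<le> (\<Sum>i<n. 1\<^sup>2) * (\<Sum>i<n. \<bar>z i\<bar>\<^sup>2)"
      using Cauchy_Schwarz_ineq_sum[of "\<lambda>_. 1" "\<lambda>i. \<bar>z i\<bar>" "{..<n}"] by simp
    also have "\<dots> = (sqrt n * r)\<^sup>2" by (simp add: power_mult_distrib r2)
    finally have z1: "(\<Sum>i<n. \<bar>z i\<bar>) \<le> sqrt n * r"
      using r by (intro power2_le_imp_le[of "\<Sum>i<n. \<bar>z i\<bar>"]) auto
    have rsum: "r = (\<Sum>i<n. (z i)\<^sup>2 / r)"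
      using r by (simp add: power2_eq_square[of r] flip: sum_divide_distrib r2)
    have "r / 2 = r - sqrt n * r / s" using n by (simp add: s_def)
    also have "\<dots> \<le> r - (\<Sum>i<n. \<bar>z i\<bar>) / s" using z1 s by (simp add: divide_right_mono)
    also have "\<dots> = (\<Sum>i<n. (z i)\<^sup>2 / r - \<bar>z i\<bar> / s)"
      unfolding sum_subtractf rsum[symmetric] by (simp add: sum_divide_distrib)
    also have "\<dots> \<le> (\<Sum>i<n. real_of_int (k i) / s * z i)"
    proof (rule sum_mono)
      fix i assume i: "i \<in> {..<n}"
      have "(z i)\<^sup>2 / r - \<bar>z i\<bar> / s = (y i - 1) / s * \<bar>z i\<bar>"
        using s r by (simp add: y_def field_simps power2_eq_square)
      also have "\<dots> \<le> real_of_int \<lfloor>y i\<rfloor> / s * \<bar>z i\<bar>"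
        using s fl by (intro mult_right_mono divide_right_mono) auto
      also have "\<dots> = real_of_int (k i) / s * z i" using i by (simp add: k_def)
      finally show "(z i)\<^sup>2 / r - \<bar>z i\<bar> / s \<le> real_of_int (k i) / s * z i" .
    qed
    finally have "r / 2 \<le> (\<Sum>i<n. real_of_int (k i) / s * z i)" .
    then show ?thesis unfolding r_def U_def using kK by (intro bexI[OF _ imageI[OF kK]])
  qed
  moreover have "finite U" using fK by (simp add: U_def)
  ultimately show thesis using that cU norm_U by blast
qed

section \<open>D-convex spaces\<close>

lemma orlicz_jensen:
  assumes \<Phi>: "orlicz_function \<Phi>" and X: "integrable unit_leb X"
  shows "ennreal (\<Phi> (\<integral>t. X t \<partial>unit_leb)) \<le> (\<integral>\<^sup>+ t. ennreal (\<Phi> (X t)) \<partial>unit_leb)"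
proof (cases "(\<integral>\<^sup>+ t. ennreal (\<Phi> (X t)) \<partial>unit_leb) = \<infinity>")
  case False
  have nn: "0 \<le> \<Phi> u" for u using \<Phi> by (simp add: orlicz_function_def)
  have [measurable]: "X \<in> borel_measurable unit_leb" using X by simp
  have m: "(\<lambda>t. \<Phi> (X t)) \<in> borel_measurable unit_leb"
    by (rule measurable_compose[OF _ orlicz_measurable[OF \<Phi>]]) simp
  have int: "integrable unit_leb (\<lambda>t. \<Phi> (X t))"
    using False nn m by (intro integrableI_nonneg) (auto simp: less_top)
  have "\<Phi> (\<integral>t. X t \<partial>unit_leb) \<le> (\<integral>t. \<Phi> (X t) \<partial>unit_leb)"
    using \<Phi> X int by (intro unit_leb.jensens_inequality[where I = UNIV]) (auto simp: orlicz_function_def)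
  then show ?thesis using nn int by (subst nn_integral_eq_integral) (auto intro: ennreal_leI)
qed simp

lemma L1_integrable:
  assumes "x \<in> carrier_of L1_norm"
  shows "integrable unit_leb x" "enn2real (L1_norm x) = (\<integral>t. \<bar>x t\<bar> \<partial>unit_leb)"
  using assms by (auto simp: carrier_of_def L1_norm_def integrable_iff_bounded integral_eq_nn_integral)

lemma L1_norm_eq_integral:
  "integrable unit_leb x \<Longrightarrow> L1_norm x = ennreal (\<integral>t. \<bar>x t\<bar> \<partial>unit_leb)"
  unfolding L1_norm_def by (intro nn_integral_eq_integral) auto

text \<open>The signs are averaged over the second copy of \<open>[0,1]\<close>; by symmetry each \<open>x i\<close> may be
  replaced by its absolute value, after which Jensen's inequality applies for fixed signs.\<close>

lemma rademacher_orlicz_integral_le: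
  fixes x :: "nat \<Rightarrow> real \<Rightarrow> real"
  assumes \<Phi>: "orlicz_function \<Phi>" and l: "0 < l"
    and x: "\<And>i. i \<in> {1..n} \<Longrightarrow> x i \<in> carrier_of L1_norm"
    and le: "\<And>\<epsilon>. (\<And>i. i \<in> {1..n} \<Longrightarrow> \<epsilon> i \<in> {-1, 1::real}) \<Longrightarrow>
      (\<integral>\<^sup>+ t. ennreal (\<Phi> ((\<Sum>i=1..n. \<epsilon> i * x i t) / l)) \<partial>unit_leb) \<le> 1"
  shows "(\<integral>\<^sup>+ s. ennreal (\<Phi> ((\<Sum>i=1..n. enn2real (L1_norm (x i)) * rademacher i s) / l)) \<partial>unit_leb) \<le> 1"
proof -
  have xm [measurable]: "i \<in> {1..n} \<Longrightarrow> x i \<in> borel_measurable unit_leb" for i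
    using x by (auto simp: carrier_of_def)
  note [measurable] = rademacher_measurable orlicz_measurable[OF \<Phi>]
  define H where "H u = ennreal (\<Phi> (u / l))" for u
  have H [measurable]: "H \<in> borel_measurable borel" unfolding H_def by measurable
  define F where "F s t = H (\<Sum>i=1..n. \<bar>x i t\<bar> * rademacher i s)" for s t
  have FM: "(\<lambda>(s, t). F s t) \<in> borel_measurable (unit_leb \<Otimes>\<^sub>M unit_leb)"
    unfolding F_def by measurable
  interpret P: pair_sigma_finite unit_leb unit_leb ..
  have 1: "H (\<Sum>i=1..n. enn2real (L1_norm (x i)) * rademacher i s) \<le> (\<integral>\<^sup>+ t. F s t \<partial>unit_leb)" for s
  proof -
    let ?X = "\<lambda>t. (\<Sum>i=1..n. \<bar>x i t\<bar> * rademacher i s) / l"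
    have int: "integrable unit_leb (\<lambda>t. \<bar>x i t\<bar> * rademacher i s)" if "i \<in> {1..n}" for i
      using L1_integrable(1)[OF x[OF that]] by auto
    have eq: "(\<integral>t. ?X t \<partial>unit_leb) = (\<Sum>i=1..n. enn2real (L1_norm (x i)) * rademacher i s) / l"
      using int L1_integrable(2)[OF x] by (simp add: Bochner_Integration.integral_sum)
    have "integrable unit_leb ?X" by (intro integrable_divide Bochner_Integration.integrable_sum int)
    then show ?thesis using orlicz_jensen[OF \<Phi>, of ?X] unfolding eq F_def H_def by blast
  qed
  have flip: "(\<integral>\<^sup>+ s. F s t \<partial>unit_leb) = (\<integral>\<^sup>+ s. H (\<Sum>i=1..n. x i t * rademacher i s) \<partial>unit_leb)" for t
    using nn_integral_rademacher_abs[OF H, of 0 "\<lambda>i. x i t" n] by (simp add: F_def)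
  have "(\<integral>\<^sup>+ s. H (\<Sum>i=1..n. enn2real (L1_norm (x i)) * rademacher i s) \<partial>unit_leb)
      \<le> (\<integral>\<^sup>+ s. \<integral>\<^sup>+ t. F s t \<partial>unit_leb \<partial>unit_leb)"
    by (intro nn_integral_mono 1)
  also have "\<dots> = (\<integral>\<^sup>+ t. \<integral>\<^sup>+ s. F s t \<partial>unit_leb \<partial>unit_leb)"
    by (rule P.Fubini'[OF FM, symmetric])
  also have "\<dots> = (\<integral>\<^sup>+ t. \<integral>\<^sup>+ s. H (\<Sum>i=1..n. x i t * rademacher i s) \<partial>unit_leb \<partial>unit_leb)"
    unfolding flip ..
  also have "\<dots> = (\<integral>\<^sup>+ s. \<integral>\<^sup>+ t. H (\<Sum>i=1..n. x i t * rademacher i s) \<partial>unit_leb \<partial>unit_leb)"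
    by (rule P.Fubini') measurable
  also have "\<dots> \<le> (\<integral>\<^sup>+ s. 1 \<partial>unit_leb)"
  proof (rule nn_integral_mono_AE)
    show "AE s in unit_leb. (\<integral>\<^sup>+ t. H (\<Sum>i=1..n. x i t * rademacher i s) \<partial>unit_leb) \<le> 1"
      using AE_rademacher
    proof eventually_elim
      case (elim s)
      then show ?case using le[of "\<lambda>i. rademacher i s"] by (simp add: H_def mult.commute)
    qed
  qed
  also have "\<dots> = 1" by simp
  finally show ?thesis by (simp add: H_def)
qed

section \<open>The choice of signs\<close>

lemma ri_normed: "ri_space E \<Longrightarrow> normed_function_space E"
  unfolding ri_space_def banach_function_space_def by (elim conjE)

lemma carrier_scale:
  assumes "normed_function_space E" "f \<in> carrier_of E"
  shows "(\<lambda>t. a * f t) \<in> carrier_of E" "E (\<lambda>t. a * f t) = ennreal \<bar>a\<bar> * E f"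
proof -
  show *: "E (\<lambda>t. a * f t) = ennreal \<bar>a\<bar> * E f"
    using assms unfolding normed_function_space_def by blast
  show "(\<lambda>t. a * f t) \<in> carrier_of E"
    using assms(2) * by (auto simp: carrier_of_def ennreal_mult_less_top)
qed

lemma carrier_diff:
  assumes E: "normed_function_space E" and f: "f \<in> carrier_of E" and g: "g \<in> carrier_of E"
  shows "(\<lambda>t. f t - g t) \<in> carrier_of E" "E (\<lambda>t. f t - g t) \<le> E f + E g"
proof -
  have g': "(\<lambda>t. - g t) \<in> carrier_of E" "E (\<lambda>t. - g t) = E g"
    using carrier_scale[OF E g, of "-1"] by auto
  have tri: "\<forall>f\<in>carrier_of E. \<forall>g\<in>carrier_of E. E (\<lambda>t. f t + g t) \<le> E f + E g"
    using E unfolding normed_function_space_def by (elim conjE)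
  have "E (\<lambda>t. f t + (- g t)) \<le> E f + E (\<lambda>t. - g t)"
    by (rule bspec[OF bspec[OF tri f] g'(1)])
  then show le: "E (\<lambda>t. f t - g t) \<le> E f + E g" using g'(2) by simp
  have "E f + E g < \<infinity>" using f g by (auto simp: carrier_of_def)
  then have "E (\<lambda>t. f t - g t) < \<infinity>" by (rule le_less_trans[OF le])
  then show "(\<lambda>t. f t - g t) \<in> carrier_of E" using f g by (auto simp: carrier_of_def)
qed

lemma D_convex_sign_choice:
  assumes E: "ri_space E" and D: "D_convex E"
  shows "\<exists>c::real. c > 0 \<and>
      (\<forall>n\<ge>1. \<forall>x :: nat \<Rightarrow> real \<Rightarrow> real. (\<forall>i\<in>{1..n}. x i \<in> carrier_of L1_norm) \<longrightarrow>
        (\<exists>\<epsilon> :: nat \<Rightarrow> real. (\<forall>i\<in>{1..n}. \<epsilon> i \<in> {-1, 1}) \<and>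
          E (\<lambda>t. \<Sum>i=1..n. \<epsilon> i * x i t) \<ge>
            ennreal (inverse c) * E (\<lambda>t. \<Sum>i=1..n. enn2real (L1_norm (x i)) * rademacher i t)))"
proof -
  obtain F c where F: "\<And>\<Phi>. \<Phi> \<in> F \<Longrightarrow> orlicz_function \<Phi>" and c: "0 < c"
    and lo: "\<And>x. x \<in> carrier_of E \<Longrightarrow> ennreal (inverse c) * E x \<le> (SUP \<Phi>\<in>F. orlicz_norm \<Phi> x)"
    and up: "\<And>x. x \<in> carrier_of E \<Longrightarrow> (SUP \<Phi>\<in>F. orlicz_norm \<Phi> x) \<le> E x"
    using D unfolding D_convex_def by blast
  show ?thesis
  \<comment> \<open>Doubling \<open>c\<close> leaves room for a contradiction: if every choice of
    signs failed, all Orlicz norms of the Rademacher sum \<open>R\<close> would be at most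
    \<open>l\<close>, while D-convexity puts their supremum at \<open>2 * l\<close> or more.\<close>
  proof (intro exI[of _ "2 * c"] conjI allI impI)
    show "0 < 2 * c" using c by simp
    fix n :: nat and x :: "nat \<Rightarrow> real \<Rightarrow> real"
    assume x: "\<forall>i\<in>{1..n}. x i \<in> carrier_of L1_norm"
    define R where "R = (\<lambda>t. \<Sum>i=1..n. enn2real (L1_norm (x i)) * rademacher i t)"
    have "\<bar>R t\<bar> \<le> (\<Sum>i=1..n. enn2real (L1_norm (x i)))" for t
      unfolding R_def
      by (rule order_trans[OF sum_abs], rule sum_mono)
        (use mult_left_mono[OF abs_rademacher_le] in \<open>simp add: abs_mult\<close>)
    moreover have "R \<in> borel_measurable unit_leb" unfolding R_def by (rule rademacher_sum_measurable)
    ultimately have Rc: "R \<in> carrier_of E" using ri_bounded_carrier[OF E] by blast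
    then obtain r where r: "E R = ennreal r" "0 \<le> r" by (cases "E R") (auto simp: carrier_of_def)
    define l where "l = r / (2 * c)"
    have l: "ennreal (inverse (2 * c)) * E R = ennreal l"
      unfolding r(1) l_def using c r(2) by (subst ennreal_mult[symmetric]) (auto simp: field_simps)
    have l2: "ennreal (inverse c) * E R = ennreal (2 * l)"
      unfolding r(1) l_def using c r(2) by (subst ennreal_mult[symmetric]) (auto simp: field_simps)
    show "\<exists>\<epsilon> :: nat \<Rightarrow> real. (\<forall>i\<in>{1..n}. \<epsilon> i \<in> {-1, 1}) \<and>
          ennreal (inverse (2 * c)) * E (\<lambda>t. \<Sum>i=1..n. enn2real (L1_norm (x i)) * rademacher i t)
            \<le> E (\<lambda>t. \<Sum>i=1..n. \<epsilon> i * x i t)"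
    proof (rule ccontr)
      assume *: "\<not> ?thesis"
      have small: "E (\<lambda>t. \<Sum>i=1..n. \<epsilon> i * x i t) < ennreal l"
        if e: "\<And>i. i \<in> {1..n} \<Longrightarrow> \<epsilon> i \<in> {-1, 1}" for \<epsilon> :: "nat \<Rightarrow> real"
      proof (rule ccontr)
        assume "\<not> E (\<lambda>t. \<Sum>i=1..n. \<epsilon> i * x i t) < ennreal l"
        then have "ennreal l \<le> E (\<lambda>t. \<Sum>i=1..n. \<epsilon> i * x i t)" by (simp only: not_less)
        then show False using * unfolding R_def[symmetric] l
          by (elim notE) (intro exI[of _ \<epsilon>] conjI ballI e)
      qed
      \<comment> \<open>Nothing lies strictly below 0 in \<open>ennreal\<close>, so the mere failure
        of one choice of signs forces \<open>l\<close> to be positive.\<close>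
      have l0: "0 < l" using small[of "\<lambda>_. 1"] by (cases "0 < l") (auto simp: ennreal_neg)
      have "orlicz_norm \<Phi> R \<le> ennreal l" if \<Phi>: "\<Phi> \<in> F" for \<Phi>
      proof (rule orlicz_norm_le[OF l0])
        show "(\<integral>\<^sup>+ t. ennreal (\<Phi> (R t / l)) \<partial>unit_leb) \<le> 1"
          unfolding R_def
        proof (rule rademacher_orlicz_integral_le[OF F[OF \<Phi>] l0])
          fix \<epsilon> :: "nat \<Rightarrow> real" assume e: "\<And>i. i \<in> {1..n} \<Longrightarrow> \<epsilon> i \<in> {-1, 1}"
          let ?S = "\<lambda>t. \<Sum>i=1..n. \<epsilon> i * x i t"
          have "?S \<in> borel_measurable unit_leb"
            using x by (intro borel_measurable_sum borel_measurable_times) (auto simp: carrier_of_def)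
          \<comment> \<open>The \<open>x i\<close> are only in L_1; it is the assumed smallness that
            places the signed sum in E, where the upper D-convexity estimate applies.\<close>
          moreover have "E ?S < \<infinity>" using small[OF e] by (rule less_trans) simp_all
          ultimately have Sc: "?S \<in> carrier_of E" by (simp add: carrier_of_def)
          have "orlicz_norm \<Phi> ?S \<le> (SUP \<Phi>\<in>F. orlicz_norm \<Phi> ?S)" using \<Phi> by (rule SUP_upper)
          also have "\<dots> \<le> E ?S" by (rule up[OF Sc])
          also have "\<dots> < ennreal l" using e by (rule small)
          finally show "(\<integral>\<^sup>+ t. ennreal (\<Phi> (?S t / l)) \<partial>unit_leb) \<le> 1"
            by (rule orlicz_integral_le_1[OF F[OF \<Phi>]])
        qed (use x in auto)
      qed
      then have "(SUP \<Phi>\<in>F. orlicz_norm \<Phi> R) \<le> ennreal l" by (rule SUP_least)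
      then have "ennreal (inverse c) * E R \<le> ennreal l" using lo[OF Rc] by (rule order_trans[rotated])
      then have "ennreal (2 * l) \<le> ennreal l" unfolding l2 .
      then show False using l0 by simp
    qed
  qed
qed

section \<open>Growth of Orlicz functions forced by an infinite-dimensional subspace\<close>

lemma independent_extend:
  assumes V: "ae_infinite_dimensional V" and n: "\<And>i. i < n \<Longrightarrow> v i \<in> V"
  shows "\<exists>x\<in>V. \<forall>f\<in>lin_comb v n. \<not> (AE t in unit_leb. x t = f t)"
proof -
  let ?B = "v ` {..<n}"
  have B: "finite ?B" "?B \<subseteq> V" using n by auto
  have "\<not> (\<forall>x\<in>V. \<exists>a :: (real \<Rightarrow> real) \<Rightarrow> real. AE t in unit_leb. x t = (\<Sum>b\<in>?B. a b * b t))"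
  proof
    assume *: "\<forall>x\<in>V. \<exists>a :: (real \<Rightarrow> real) \<Rightarrow> real. AE t in unit_leb. x t = (\<Sum>b\<in>?B. a b * b t)"
    show False
      by (rule notE[OF V[unfolded ae_infinite_dimensional_def]], intro exI[of _ ?B] conjI B *)
  qed
  then obtain x where x: "x \<in> V"
    and no: "\<And>a :: (real \<Rightarrow> real) \<Rightarrow> real. \<not> (AE t in unit_leb. x t = (\<Sum>b\<in>?B. a b * b t))"
    by auto
  have "\<not> (AE t in unit_leb. x t = f t)" if f: "f \<in> lin_comb v n" for f
  proof -
    obtain c where c: "f = (\<lambda>t. \<Sum>j<n. c j * v j t)" using f by (auto simp: lin_comb_def)
    \<comment> \<open>The definition of dimension sums over a set of functions, so coefficients of
      repeated \<open>v j\<close> are added up.\<close>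
    define a where "a b = (\<Sum>j\<in>{j \<in> {..<n}. v j = b}. c j)" for b
    have "f t = (\<Sum>b\<in>?B. a b * b t)" for t
    proof -
      have "f t = (\<Sum>b\<in>?B. \<Sum>j\<in>{j \<in> {..<n}. v j = b}. c j * v j t)"
        unfolding c by (rule sum.image_gen) simp
      also have "\<dots> = (\<Sum>b\<in>?B. a b * b t)"
        unfolding a_def sum_distrib_right by (intro sum.cong refl) auto
      finally show ?thesis .
    qed
    then show ?thesis using no[of a] by simp
  qed
  with x show ?thesis by (intro bexI[of _ x] ballI)
qed

lemma independent_sequence:
  assumes V: "ae_infinite_dimensional V"
  shows "\<exists>v. (\<forall>i<n. v i \<in> V) \<and> (\<forall>k<n. \<forall>f\<in>lin_comb v k. \<not> (AE t in unit_leb. v k t = f t))"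
proof (induction n)
  case (Suc n)
  then obtain v where v: "\<And>i. i < n \<Longrightarrow> v i \<in> V"
    and ind: "\<And>k f. k < n \<Longrightarrow> f \<in> lin_comb v k \<Longrightarrow> \<not> (AE t in unit_leb. v k t = f t)" by blast
  have "\<exists>x\<in>V. \<forall>f\<in>lin_comb v n. \<not> (AE t in unit_leb. x t = f t)"
    by (rule independent_extend[OF V]) (rule v)
  then obtain x where x: "x \<in> V" "\<forall>f\<in>lin_comb v n. \<not> (AE t in unit_leb. x t = f t)"
    by (elim bexE)
  let ?v = "v(n := x)"
  have eq: "lin_comb ?v k = lin_comb v k" if "k \<le> n" for k
  proof -
    have "(\<Sum>j<k. c j * ?v j t) = (\<Sum>j<k. c j * v j t)" for c t
      using that by (intro sum.cong) auto
    then show ?thesis by (simp add: lin_comb_def)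
  qed
  have "\<forall>i<Suc n. ?v i \<in> V" using v x by (auto simp: less_Suc_eq)
  moreover have "\<forall>k<Suc n. \<forall>f\<in>lin_comb ?v k. \<not> (AE t in unit_leb. ?v k t = f t)"
  proof (intro allI impI ballI)
    fix k f assume that: "k < Suc n" "f \<in> lin_comb ?v k"
    show "\<not> (AE t in unit_leb. ?v k t = f t)"
    proof (cases "k = n")
      case True
      then show ?thesis using bspec[OF x(2), of f] that(2) eq[of n] by simp
    next
      case False
      then have "k < n" using that(1) by simp
      then show ?thesis using ind[of k f] that(2) eq[of k] by simp
    qed
  qed
  ultimately show ?case by (intro exI[of _ ?v] conjI)
qed simp

lemma lin_comb_subset:
  assumes V: "function_subspace V"
  shows "(\<And>i. i < n \<Longrightarrow> v i \<in> V) \<Longrightarrow> lin_comb v n \<subseteq> V"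
proof (induction n)
  case 0
  then show ?case using V by (auto simp: lin_comb_def function_subspace_def)
next
  case (Suc n)
  show ?case
  proof
    fix f assume "f \<in> lin_comb v (Suc n)"
    then obtain c where c: "f = (\<lambda>t. (\<Sum>j<n. c j * v j t) + c n * v n t)" by (auto simp: lin_comb_def)
    have "(\<lambda>t. \<Sum>j<n. c j * v j t) \<in> V" using Suc lin_combI[where v = v and k = n and c = c] by auto
    moreover have "(\<lambda>t. c n * v n t) \<in> V" using V Suc.prems[of n] by (simp add: function_subspace_def)
    ultimately show "f \<in> V" unfolding c using V by (simp add: function_subspace_def)
  qed
qed

text \<open>The factor 8 combines the 1/4 lost by the spread system with the 1/2 lost by the norming
  set. The direction that detects the length varies with the point; replacing the maximum over
  \<open>U\<close> by the sum costs the cardinality of \<open>U\<close>.\<close>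

lemma orlicz_growth:
  assumes \<Phi>: "orlicz_function \<Phi>" and V: "function_subspace V" "ae_infinite_dimensional V"
    and VL: "V \<subseteq> carrier_of L1_norm" and b: "0 < b"
    and le: "\<And>v. v \<in> V \<Longrightarrow> L1_norm v \<le> 1 \<Longrightarrow> (\<integral>\<^sup>+ t. ennreal (\<Phi> (v t / b)) \<partial>unit_leb) \<le> 1"
    and n: "0 < n"
  shows "\<Phi> (sqrt n / (8 * b)) \<le> 48 ^ n"
proof -
  have nn: "0 \<le> \<Phi> u" for u using \<Phi> by (simp add: orlicz_function_def)
  obtain v where v: "\<And>i. i < n \<Longrightarrow> v i \<in> V"
    and ind: "\<And>k f. k < n \<Longrightarrow> f \<in> lin_comb v k \<Longrightarrow> \<not> (AE t in unit_leb. v k t = f t)"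
    using independent_sequence[OF V(2), of n] by blast
  interpret ae_independent unit_leb v n
    using v VL L1_integrable(1) ind by unfold_locales auto
  obtain y where y: "\<forall>i<n. y i \<in> lin_comb v n"
    and yu: "\<forall>u. (\<Sum>i<n. (u i)\<^sup>2) \<le> 1 \<longrightarrow> (\<integral>t. \<bar>\<Sum>i<n. u i * y i t\<bar> \<partial>unit_leb) \<le> 1"
    and yi: "integrable unit_leb (\<lambda>t. sqrt (\<Sum>i<n. (y i t)\<^sup>2))"
    and yl: "sqrt n / 4 \<le> (\<integral>t. sqrt (\<Sum>i<n. (y i t)\<^sup>2) \<partial>unit_leb)"
    using exists_spread_system by (elim exE conjE)
  obtain U :: "(nat \<Rightarrow> real) set" where U: "finite U" "real (card U) \<le> 48 ^ n"
    and U1: "\<And>u. u \<in> U \<Longrightarrow> (\<Sum>i<n. (u i)\<^sup>2) \<le> 1"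
    and Ug: "\<And>z. \<exists>u\<in>U. sqrt (\<Sum>i<n. (z i)\<^sup>2) / 2 \<le> (\<Sum>i<n. u i * z i)"
    using exists_norming_set[OF n] by blast
  have "lin_comb v n \<subseteq> V" by (rule lin_comb_subset[OF V(1)]) (rule v)
  then have yV: "y i \<in> V" if "i < n" for i using y that by blast
  have yc: "lin_comb y n \<subseteq> V" by (rule lin_comb_subset[OF V(1)]) (rule yV)
  define f where "f u = (\<lambda>t. \<Sum>i<n. u i * y i t)" for u
  have fV: "f u \<in> V" for u unfolding f_def by (rule subsetD[OF yc lin_combI])
  have fm: "f u \<in> borel_measurable unit_leb" for u using fV VL by (auto simp: carrier_of_def)
  have fint: "(\<integral>\<^sup>+ t. ennreal (\<Phi> (f u t / b)) \<partial>unit_leb) \<le> 1" if u: "u \<in> U" for u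
  proof (rule le[OF fV])
    have "integrable unit_leb (f u)" using fV VL L1_integrable(1) by blast
    then have "L1_norm (f u) = ennreal (\<integral>t. \<bar>f u t\<bar> \<partial>unit_leb)" by (rule L1_norm_eq_integral)
    also have "\<dots> \<le> ennreal 1" unfolding f_def by (intro ennreal_leI yu[rule_format] U1 u)
    finally show "L1_norm (f u) \<le> 1" by simp
  qed
  define X where "X = (\<lambda>t. sqrt (\<Sum>i<n. (y i t)\<^sup>2) / (2 * b))"
  have Xi: "integrable unit_leb X" unfolding X_def using yi by auto
  have pt: "ennreal (\<Phi> (X t)) \<le> (\<Sum>u\<in>U. ennreal (\<Phi> (f u t / b)))" for t
  proof -
    obtain u where u: "u \<in> U" "sqrt (\<Sum>i<n. (y i t)\<^sup>2) / 2 \<le> f u t"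
      using Ug[of "\<lambda>i. y i t"] by (auto simp: f_def)
    have "X t \<le> f u t / b" using u(2) b by (simp add: X_def field_simps)
    moreover have "0 \<le> X t" using b by (simp add: X_def sum_nonneg)
    ultimately have "\<Phi> (X t) \<le> \<Phi> (f u t / b)" by (intro orlicz_mono[OF \<Phi>]) linarith
    then have "ennreal (\<Phi> (X t)) \<le> ennreal (\<Phi> (f u t / b))" by (rule ennreal_leI)
    also have "\<dots> \<le> (\<Sum>u\<in>U. ennreal (\<Phi> (f u t / b)))" using U(1) u(1) by (intro member_le_sum) auto
    finally show ?thesis .
  qed
  have "sqrt n / (8 * b) = (sqrt n / 4) / (2 * b)" by simp
  also have "\<dots> \<le> (\<integral>t. X t \<partial>unit_leb)"
    using yl b unfolding X_def integral_divide_zero by (intro divide_right_mono) auto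
  finally have "\<Phi> (sqrt n / (8 * b)) \<le> \<Phi> (\<integral>t. X t \<partial>unit_leb)"
    using b by (intro orlicz_mono[OF \<Phi>]) simp
  then have "ennreal (\<Phi> (sqrt n / (8 * b))) \<le> ennreal (\<Phi> (\<integral>t. X t \<partial>unit_leb))" by (rule ennreal_leI)
  also have "\<dots> \<le> (\<integral>\<^sup>+ t. ennreal (\<Phi> (X t)) \<partial>unit_leb)" by (rule orlicz_jensen[OF \<Phi> Xi])
  also have "\<dots> \<le> (\<integral>\<^sup>+ t. (\<Sum>u\<in>U. ennreal (\<Phi> (f u t / b))) \<partial>unit_leb)" by (intro nn_integral_mono pt)
  also have "\<dots> = (\<Sum>u\<in>U. \<integral>\<^sup>+ t. ennreal (\<Phi> (f u t / b)) \<partial>unit_leb)"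
  proof (rule nn_integral_sum)
    fix u
    note [measurable] = orlicz_measurable[OF \<Phi>] fm[of u]
    show "(\<lambda>t. ennreal (\<Phi> (f u t / b))) \<in> borel_measurable unit_leb" by measurable
  qed
  also have "\<dots> \<le> (\<Sum>u\<in>U. 1)" by (intro sum_mono fint)
  also have "\<dots> = ennreal (real (card U))" by (simp add: ennreal_of_nat_eq_real_of_nat)
  also have "\<dots> \<le> ennreal (48 ^ n)" using U(2) by (rule ennreal_leI)
  finally show ?thesis by (subst (asm) ennreal_le_iff) auto
qed

lemma orlicz_norm_le_exp_square:
  assumes \<Phi>: "orlicz_function \<Phi>" and b: "0 < b"
    and g: "\<And>n::nat. 0 < n \<Longrightarrow> \<Phi> (sqrt n / (8 * b)) \<le> 48 ^ n"
    and x: "x \<in> borel_measurable unit_leb"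
  shows "orlicz_norm \<Phi> x \<le> ennreal (2304 * b) * orlicz_norm exp_square x"
proof (rule le_orlicz_normI)
  show "0 < 2304 * b" using b by simp
  fix l :: real
  assume l: "0 < l" "(\<integral>\<^sup>+ t. ennreal (exp_square (x t / l)) \<partial>unit_leb) \<le> 1"
  have growth: "\<Phi> (s / (24 * b)) \<le> 48 * exp (s\<^sup>2)" for s
  proof -
    \<comment> \<open>Interpolates between the square roots of integers. Dividing by 3 pays for
      \<open>48 \<le> exp 6\<close>: the exponent \<open>6 * m\<close> is then below
      \<open>9 * (s / 3)^2\<close>, which is \<open>s^2\<close>.\<close>
    define m where "m = nat \<lfloor>(s / 3)\<^sup>2\<rfloor>"
    have m: "real m \<le> (s / 3)\<^sup>2" "(s / 3)\<^sup>2 \<le> real (Suc m)"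
      unfolding m_def using zero_le_power2[of "s / 3"] by linarith+
    have "\<bar>s / 3\<bar> \<le> sqrt (Suc m)" using real_sqrt_le_mono[OF m(2)] by simp
    then have "\<bar>s / (24 * b)\<bar> \<le> \<bar>sqrt (Suc m) / (8 * b)\<bar>"
      using b by (simp add: abs_divide abs_mult field_simps)
    then have "\<Phi> (s / (24 * b)) \<le> \<Phi> (sqrt (Suc m) / (8 * b))" by (rule orlicz_mono[OF \<Phi>])
    also have "\<dots> \<le> 48 ^ Suc m" by (rule g) simp
    also have "\<dots> = 48 * 48 ^ m" by simp
    also have "(48::real) ^ m \<le> (exp 1 ^ 6) ^ m"
    proof (rule power_mono)
      have "(2::real) ^ 6 \<le> exp 1 ^ 6" using exp_ge_add_one_self[of 1] by (intro power_mono) auto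
      then show "48 \<le> exp (1::real) ^ 6" by simp
    qed simp
    also have "(exp 1 ^ 6) ^ m = exp (real (6 * m))"
      using exp_of_nat_mult[of "6 * m" "1::real"] by (simp only: power_mult mult_1_right)
    also have "\<dots> \<le> exp (s\<^sup>2)"
    proof -
      have "real (6 * m) \<le> 9 * (s / 3)\<^sup>2" using m(1) by simp
      also have "\<dots> = s\<^sup>2" by (simp add: power_divide)
      finally show ?thesis by simp
    qed
    finally show ?thesis by simp
  qed
  have pt: "\<Phi> (x t / (2304 * b * l)) \<le> (1/2) * (exp_square (x t / l) + 1)" for t
  proof -
    \<comment> \<open>\<open>2304 = 96 * 24\<close>. By convexity the factor \<open>1/96\<close>
      turns \<open>48 * exp\<close> into \<open>exp / 2\<close>, whose integral is at most 1 because
      that of \<open>exp\<close> is at most 2.\<close>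
    have "\<Phi> (x t / (2304 * b * l)) = \<Phi> ((1/96) * ((x t / l) / (24 * b)))" by (simp add: mult_ac)
    also have "\<dots> \<le> (1/96) * \<Phi> ((x t / l) / (24 * b))" by (rule orlicz_scale_le[OF \<Phi>]) auto
    also have "\<dots> \<le> (1/96) * (48 * exp ((x t / l)\<^sup>2))" by (intro mult_left_mono growth) auto
    finally show ?thesis by simp
  qed
  have "(\<integral>\<^sup>+ t. ennreal (\<Phi> (x t / (2304 * b * l))) \<partial>unit_leb)
    \<le> (\<integral>\<^sup>+ t. ennreal (1/2) * (ennreal (exp_square (x t / l)) + 1) \<partial>unit_leb)"
  proof (rule nn_integral_mono)
    fix t
    have "ennreal (\<Phi> (x t / (2304 * b * l))) \<le> ennreal ((1/2) * (exp_square (x t / l) + 1))"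
      using pt by (rule ennreal_leI)
    also have "\<dots> = ennreal (1/2) * (ennreal (exp_square (x t / l)) + 1)"
      by (subst ennreal_mult) (auto simp flip: ennreal_plus ennreal_1)
    finally show "ennreal (\<Phi> (x t / (2304 * b * l))) \<le> ennreal (1/2) * (ennreal (exp_square (x t / l)) + 1)" .
  qed
  also have "\<dots> = ennreal (1/2) * ((\<integral>\<^sup>+ t. ennreal (exp_square (x t / l)) \<partial>unit_leb) + 1)"
    using x by (subst nn_integral_cmult) (auto simp: nn_integral_add)
  also have "\<dots> \<le> ennreal (1/2) * (ennreal 1 + ennreal 1)"
    using l(2) by (intro mult_left_mono add_mono) auto
  also have "\<dots> = 1" by (subst half_ennreal_plus) auto
  finally show "orlicz_norm \<Phi> x \<le> ennreal (2304 * b * l)"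
    using b l(1) by (intro orlicz_norm_le) auto
qed

section \<open>Embedding of G\<close>

lemma simple_function_ri_carrier:
  assumes E: "ri_space E" and s: "simple_function unit_leb s"
  shows "s \<in> carrier_of E"
proof -
  have fin: "finite (s ` {0..1})" using simple_functionD(1)[OF s] by simp
  have "\<bar>s t\<bar> \<le> Max ((\<lambda>u. \<bar>u\<bar>) ` s ` {0..1})" if "t \<in> {0..1}" for t
    using fin that by (intro Max_ge) auto
  with borel_measurable_simple_function[OF s] show ?thesis
    by (rule ri_bounded_carrier[OF E])
qed

lemma G_norm_carrier:
  "carrier_of G_norm = simple_closure (orlicz_norm exp_square)"
  by (auto simp: carrier_of_def G_norm_def simple_closure_def)

text \<open>Simple approximants in the Orlicz norm are Cauchy in E by the assumed bound; their limit
  there is shown to agree almost everywhere with the given element of G.\<close>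

lemma G_continuously_embeds:
  assumes E: "ri_space E" and C: "0 < C"
    and bound: "\<And>s. simple_function unit_leb s \<Longrightarrow> E s \<le> ennreal C * orlicz_norm exp_square s"
  shows "continuously_embeds G_norm E"
proof -
  let ?P = "orlicz_norm exp_square"
  note oe = orlicz_function_exp_square
  note nE = ri_normed[OF E]
  have main: "x \<in> carrier_of E \<and> E x \<le> ennreal C * ?P x" if x: "x \<in> simple_closure ?P" for x
  proof -
    have xm: "x \<in> borel_measurable unit_leb" using x by (simp add: simple_closure_def carrier_of_def)
    have "\<forall>n. \<exists>s. simple_function unit_leb s \<and> ?P (\<lambda>t. x t - s t) < ennreal (1 / Suc n)"
      using x by (simp add: simple_closure_def)
    from choice[OF this] obtain s where s: "\<And>n. simple_function unit_leb (s n)"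
      and sP: "\<And>n. ?P (\<lambda>t. x t - s n t) < ennreal (1 / Suc n)" by auto
    have sm: "s n \<in> borel_measurable unit_leb" for n by (rule borel_measurable_simple_function[OF s])
    have sE: "s n \<in> carrier_of E" for n by (rule simple_function_ri_carrier[OF E s])
    have diff: "?P (\<lambda>t. f t - g t) \<le> ?P f + ?P g"
      if "f \<in> borel_measurable unit_leb" "g \<in> borel_measurable unit_leb" for f g
      using orlicz_norm_triangle[OF oe that(1), of "\<lambda>t. - g t"] that(2)
      by (simp add: orlicz_norm_uminus[OF oe])
    have Es: "E (\<lambda>t. s m t - s n t) \<le> ennreal (C * (1 / Suc n + 1 / Suc m))" for m n
    proof -
      have "E (\<lambda>t. s m t - s n t) \<le> ennreal C * ?P (\<lambda>t. s m t - s n t)"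
        by (intro bound simple_function_diff s)
      also have "?P (\<lambda>t. s m t - s n t) \<le> ?P (\<lambda>t. x t - s n t) + ?P (\<lambda>t. x t - s m t)"
        using diff[of "\<lambda>t. x t - s n t" "\<lambda>t. x t - s m t"] xm sm by simp
      also have "\<dots> \<le> ennreal (1 / Suc n) + ennreal (1 / Suc m)"
        by (intro add_mono less_imp_le sP)
      also have "\<dots> = ennreal (1 / Suc n + 1 / Suc m)" by (rule ennreal_plus[symmetric]) simp_all
      also have "ennreal C * ennreal (1 / Suc n + 1 / Suc m) = ennreal (C * (1 / Suc n + 1 / Suc m))"
        using C by (intro ennreal_mult[symmetric]) (auto intro: add_nonneg_nonneg)
      finally show ?thesis by (simp add: mult_left_mono)
    qed
    have cauchy: "\<exists>K. \<forall>m\<ge>K. \<forall>n\<ge>K. E (\<lambda>t. s m t - s n t) < ennreal e" if e: "0 < e" for e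
    proof -
      obtain K :: nat where K: "2 * C / e < real K" using reals_Archimedean2 by blast
      have "E (\<lambda>t. s m t - s n t) < ennreal e" if "K \<le> m" "K \<le> n" for m n
      proof -
        have K0: "0 < K" using K C e by (metis divide_pos_pos mult_pos_pos of_nat_0_less_iff order_less_trans zero_less_numeral)
        have "1 / Suc n + 1 / Suc m \<le> 1 / K + 1 / K"
          using that K0 by (intro add_mono divide_left_mono) auto
        then have "C * (1 / Suc n + 1 / Suc m) \<le> C * (1 / K + 1 / K)" using C by (intro mult_left_mono) auto
        also have "\<dots> < e" using K K0 e by (simp add: field_simps)
        finally show ?thesis using Es[of m n] e by (meson ennreal_lessI le_less_trans)
      qed
      then show ?thesis by blast
    qed
    have complete: "\<forall>u :: nat \<Rightarrow> real \<Rightarrow> real.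
        (\<forall>n. u n \<in> carrier_of E) \<and>
        (\<forall>e>0. \<exists>K. \<forall>m\<ge>K. \<forall>n\<ge>K. E (\<lambda>t. u m t - u n t) < ennreal e) \<longrightarrow>
        (\<exists>x \<in> carrier_of E. (\<lambda>n. E (\<lambda>t. u n t - x t)) \<longlonglongrightarrow> 0)"
      using E unfolding ri_space_def banach_function_space_def by (elim conjE)
    have "\<exists>y \<in> carrier_of E. (\<lambda>n. E (\<lambda>t. s n t - y t)) \<longlonglongrightarrow> 0"
      by (rule complete[rule_format]) (intro conjI allI impI sE cauchy)
    then obtain y where y: "y \<in> carrier_of E" and lim: "(\<lambda>n. E (\<lambda>t. s n t - y t)) \<longlonglongrightarrow> 0"
      by (elim bexE)
    have ym: "y \<in> borel_measurable unit_leb" using y by (simp add: carrier_of_def)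
    have inv_lim: "(\<lambda>n. ennreal (a * (1 / Suc n))) \<longlonglongrightarrow> 0" for a
    proof -
      have "(\<lambda>n. a * (1 / real (Suc n))) \<longlonglongrightarrow> a * 0"
        by (intro tendsto_mult_left LIMSEQ_Suc lim_1_over_n)
      then show ?thesis using tendsto_ennrealI by fastforce
    qed
    \<comment> \<open>Both limits are compared in L_1, which is weaker than either norm.\<close>
    have "L1_norm (\<lambda>t. x t - y t) \<le> ennreal (2 * (1 / Suc n)) + E (\<lambda>t. s n t - y t)" for n
    proof -
      have "L1_norm (\<lambda>t. x t - y t) \<le> (\<integral>\<^sup>+ t. ennreal \<bar>x t - s n t\<bar> + ennreal \<bar>s n t - y t\<bar> \<partial>unit_leb)"
        unfolding L1_norm_def by (intro nn_integral_mono) (simp flip: ennreal_plus)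
      also have "\<dots> = L1_norm (\<lambda>t. x t - s n t) + L1_norm (\<lambda>t. s n t - y t)"
        unfolding L1_norm_def using xm ym sm by (intro nn_integral_add) auto
      also have "\<dots> \<le> ennreal 2 * ?P (\<lambda>t. x t - s n t) + E (\<lambda>t. s n t - y t)"
        using xm ym sm by (intro add_mono L1_norm_le_orlicz_exp_square ri_L1_norm_le[OF E]) auto
      also have "\<dots> \<le> ennreal 2 * ennreal (1 / Suc n) + E (\<lambda>t. s n t - y t)"
        by (intro add_mono mult_left_mono less_imp_le[OF sP]) auto
      also have "ennreal 2 * ennreal (1 / Suc n) = ennreal (2 * (1 / Suc n))"
        by (rule ennreal_mult[symmetric]) auto
      finally show ?thesis .
    qed
    moreover have "(\<lambda>n. ennreal (2 * (1 / Suc n)) + E (\<lambda>t. s n t - y t)) \<longlonglongrightarrow> 0 + 0"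
      by (intro tendsto_add inv_lim lim)
    ultimately have "L1_norm (\<lambda>t. x t - y t) \<le> 0 + 0"
      by (intro LIMSEQ_le_const) blast+
    then have "AE t in unit_leb. ennreal \<bar>x t - y t\<bar> = 0"
      unfolding L1_norm_def using xm ym by (subst nn_integral_0_iff_AE[symmetric]) auto
    \<comment> \<open>In this form the ideal property of E transfers both membership and the norm
      bound from \<open>y\<close> to \<open>x\<close>.\<close>
    then have "AE t in unit_leb. \<bar>x t\<bar> \<le> \<bar>y t\<bar>" by eventually_elim simp
    moreover have "\<forall>y \<in> carrier_of E. \<forall>x \<in> borel_measurable unit_leb.
        (AE t in unit_leb. \<bar>x t\<bar> \<le> \<bar>y t\<bar>) \<longrightarrow> x \<in> carrier_of E \<and> E x \<le> E y"
      using E unfolding ri_space_def by (elim conjE)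
    ultimately have xE: "x \<in> carrier_of E" "E x \<le> E y" using y xm by blast+
    have "E x \<le> ennreal C * ?P x + (ennreal (C * (1 / Suc n)) + E (\<lambda>t. s n t - y t))" for n
    proof -
      note d = carrier_diff[OF nE sE[of n] y]
      have "E y \<le> E (s n) + E (\<lambda>t. s n t - y t)"
        using carrier_diff(2)[OF nE sE[of n] d(1)] by simp
      also have "E (s n) \<le> ennreal C * ?P (s n)" by (intro bound s)
      also have "?P (s n) \<le> ?P x + ?P (\<lambda>t. x t - s n t)"
        using diff[of x "\<lambda>t. x t - s n t"] xm sm by simp
      also have "\<dots> \<le> ?P x + ennreal (1 / Suc n)" by (intro add_mono less_imp_le sP order_refl)
      finally have "E y \<le> ennreal C * (?P x + ennreal (1 / Suc n)) + E (\<lambda>t. s n t - y t)"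
        by (simp add: mult_left_mono add_right_mono)
      moreover have "ennreal (C * (1 / Suc n)) = ennreal C * ennreal (1 / Suc n)"
        using C by (intro ennreal_mult) auto
      ultimately show ?thesis using order_trans[OF xE(2)] by (simp only: distrib_left add.assoc)
    qed
    moreover have "(\<lambda>n. ennreal C * ?P x + (ennreal (C * (1 / Suc n)) + E (\<lambda>t. s n t - y t)))
        \<longlonglongrightarrow> ennreal C * ?P x + (0 + 0)"
      by (intro tendsto_add inv_lim lim tendsto_const)
    ultimately have "E x \<le> ennreal C * ?P x + (0 + 0)"
      by (intro LIMSEQ_le_const) blast+
    then show ?thesis using xE(1) by simp
  qed
  have "E x \<le> ennreal C * G_norm x" if "x \<in> simple_closure ?P" for x
    using main[OF that] that by (simp add: G_norm_def)
  with main show ?thesis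
    unfolding continuously_embeds_def G_norm_carrier by blast
qed

section \<open>The span of the Rademacher functions\<close>

lemma rademacher_span_eq:
  assumes "f \<in> lin_comb (\<lambda>i. rademacher (Suc i)) k"
  obtains a where "f = (\<lambda>t. \<Sum>i=1..k. a i * rademacher i t)"
proof -
  obtain c where "f = (\<lambda>t. \<Sum>i<k. c i * rademacher (Suc i) t)" using assms by (auto simp: lin_comb_def)
  \<comment> \<open>\<open>lin_comb\<close> counts from 0, whereas the Rademacher functions start at
    index 1.\<close>
  then have "f = (\<lambda>t. \<Sum>i=1..k. c (i - 1) * rademacher i t)" by (simp add: sum.atLeast1_atMost_eq)
  then show thesis by (rule that)
qed

lemma rademacher_sum_simple:
  "simple_function unit_leb (\<lambda>t. \<Sum>i=1..n. a i * rademacher i t)"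
proof -
  have r: "simple_function unit_leb (rademacher i)" for i
  proof -
    have "finite (rademacher i ` {0..1})"
      by (rule finite_subset[of _ "{-1, 0, 1}"]) (auto simp: rademacher_def sgn_real_def)
    then show ?thesis
      using rademacher_measurable[of i] by (simp add: simple_function_borel_measurable)
  qed
  show ?thesis by (intro simple_function_sum simple_function_mult simple_function_const r)
qed

text \<open>A finite set in the span involves only the first \<open>N\<close> functions for some
  \<open>N\<close>; if it spanned everything, the next Rademacher function would be a combination of
  these almost everywhere, against orthonormality.\<close>

lemma rademacher_span_infinite_dimensional:
  "ae_infinite_dimensional (\<Union>k. lin_comb (\<lambda>i. rademacher (Suc i)) k)"
  unfolding ae_infinite_dimensional_def
proof
  let ?\<rho> = "\<lambda>i. rademacher (Suc i)"
  let ?V = "\<Union>k. lin_comb ?\<rho> k"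
  assume "\<exists>B. finite B \<and> B \<subseteq> ?V \<and>
    (\<forall>x\<in>?V. \<exists>a :: (real \<Rightarrow> real) \<Rightarrow> real. AE t in unit_leb. x t = (\<Sum>b\<in>B. a b * b t))"
  then obtain B where B: "finite B" "B \<subseteq> ?V"
    and span: "\<forall>x\<in>?V. \<exists>a :: (real \<Rightarrow> real) \<Rightarrow> real. AE t in unit_leb. x t = (\<Sum>b\<in>B. a b * b t)"
    by (elim exE conjE)
  have "\<exists>N. \<forall>a :: (real \<Rightarrow> real) \<Rightarrow> real. (\<lambda>t. \<Sum>b\<in>B. a b * b t) \<in> lin_comb ?\<rho> N"
    using B
  proof (induction B rule: finite_induct)
    case empty
    show ?case using lin_combI[where v = ?\<rho> and k = 0] by (intro exI[of _ 0]) simp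
  next
    case (insert b B)
    then obtain N where N: "\<And>a :: (real \<Rightarrow> real) \<Rightarrow> real. (\<lambda>t. \<Sum>b\<in>B. a b * b t) \<in> lin_comb ?\<rho> N" by auto
    obtain k where k: "b \<in> lin_comb ?\<rho> k" using insert.prems by auto
    have "(\<lambda>t. a b * b t + (\<Sum>b\<in>B. a b * b t)) \<in> lin_comb ?\<rho> (N + k)" for a :: "(real \<Rightarrow> real) \<Rightarrow> real"
    proof (intro lin_comb_add lin_comb_scale)
      show "b \<in> lin_comb ?\<rho> (N + k)" using k lin_comb_mono[of k "N + k" ?\<rho>] by auto
      show "(\<lambda>t. \<Sum>b\<in>B. a b * b t) \<in> lin_comb ?\<rho> (N + k)" using N lin_comb_mono[of N "N + k" ?\<rho>] by auto
    qed
    then show ?case using insert.hyps by (intro exI[of _ "N + k"]) simp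
  qed
  then obtain N where N: "\<And>a :: (real \<Rightarrow> real) \<Rightarrow> real. (\<lambda>t. \<Sum>b\<in>B. a b * b t) \<in> lin_comb ?\<rho> N" by blast
  have "?\<rho> N \<in> ?V" using lin_comb_base[of N "Suc N" ?\<rho>] by blast
  then obtain a where ae: "AE t in unit_leb. rademacher (Suc N) t = (\<Sum>b\<in>B. a b * b t)"
    using span by blast
  obtain d where d: "(\<lambda>t. \<Sum>b\<in>B. a b * b t) = (\<lambda>t. \<Sum>i=1..N. d i * rademacher i t)"
    using N[of a] by (rule rademacher_span_eq)
  \<comment> \<open>The coefficients of the difference, which vanishes almost everywhere although
    its second moment is at least 1.\<close>
  define e where "e i = (if i = Suc N then -1 else d i)" for i
  have se: "(\<Sum>i=1..Suc N. e i * rademacher i t) = (\<Sum>i=1..N. d i * rademacher i t) - rademacher (Suc N) t" for t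
    by (simp add: e_def)
  have "AE t in unit_leb. ennreal ((0 + (\<Sum>i=1..Suc N. e i * rademacher i t))\<^sup>2) = 0"
    using ae
  proof eventually_elim
    case (elim t)
    then show ?case unfolding se using fun_cong[OF d, of t] by simp
  qed
  then have "(\<integral>\<^sup>+ t. ennreal ((0 + (\<Sum>i=1..Suc N. e i * rademacher i t))\<^sup>2) \<partial>unit_leb) = (\<integral>\<^sup>+ t. 0 \<partial>unit_leb)"
    by (rule nn_integral_cong_AE)
  then have "ennreal (0\<^sup>2 + (\<Sum>i=1..Suc N. (e i)\<^sup>2)) = 0"
    unfolding rademacher_second_moment by simp
  moreover have "(1::real) \<le> 0\<^sup>2 + (\<Sum>i=1..Suc N. (e i)\<^sup>2)" by (simp add: e_def sum_nonneg)
  ultimately show False by (simp only: ennreal_eq_0_iff)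
qed

lemma not_strictly_singular_if_embeds:
  assumes E: "ri_space E" and G: "continuously_embeds G_norm E"
  shows "\<not> strictly_singular E L1_norm (\<lambda>x. x)"
proof -
  let ?\<rho> = "\<lambda>i. rademacher (Suc i)"
  let ?V = "\<Union>k. lin_comb ?\<rho> k"
  obtain C :: real where sub: "carrier_of G_norm \<subseteq> carrier_of E"
    and C: "\<forall>x\<in>carrier_of G_norm. E x \<le> ennreal C * G_norm x"
    using G unfolding continuously_embeds_def by (elim conjE exE)
  \<comment> \<open>The embedding constant may be any real; enlarging it makes division possible.
    The \<open>8 * D\<close> below is the upper constant \<open>2 * D\<close> over the lower
    constant \<open>1/4\<close> of Khinchine's inequality.\<close>
  define D where "D = max C 1"
  have D: "1 \<le> D" "ennreal C \<le> ennreal D" by (auto simp: D_def intro: ennreal_leI)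
  have bnd: "f \<in> carrier_of E \<and> ennreal (1 / (8 * D)) * E f \<le> L1_norm f" if f: "f \<in> ?V" for f
  proof -
    obtain k where "f \<in> lin_comb ?\<rho> k" using f by blast
    then obtain a where a: "f = (\<lambda>t. \<Sum>i=1..k. a i * rademacher i t)" by (rule rademacher_span_eq)
    define \<sigma> where "\<sigma> = sqrt (\<Sum>i=1..k. (a i)\<^sup>2)"
    have \<sigma>: "0 \<le> \<sigma>" by (simp add: \<sigma>_def sum_nonneg)
    have s: "simple_function unit_leb f" unfolding a by (rule rademacher_sum_simple)
    have fin: "orlicz_norm exp_square f \<le> ennreal (2 * \<sigma>)"
      unfolding a \<sigma>_def by (rule orlicz_norm_rademacher_le)
    \<comment> \<open>A simple function of finite Orlicz norm approximates itself.\<close>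
    have fc: "f \<in> simple_closure (orlicz_norm exp_square)"
    proof -
      have "orlicz_norm exp_square f < \<infinity>" using fin by (rule le_less_trans) simp
      moreover have "orlicz_norm exp_square (\<lambda>t. f t - f t) < ennreal e" if "0 < e" for e
        using that by (simp add: orlicz_norm_zero[OF orlicz_function_exp_square])
      ultimately show ?thesis
        using s borel_measurable_simple_function[OF s] unfolding simple_closure_def carrier_of_def by blast
    qed
    have "E f \<le> ennreal C * G_norm f" using C fc unfolding G_norm_carrier by (rule bspec)
    also have "\<dots> \<le> ennreal D * ennreal (2 * \<sigma>)"
      using D fin fc by (intro mult_mono) (auto simp: G_norm_def)
    also have "\<dots> = ennreal (2 * D * \<sigma>)" using D \<sigma> by (subst ennreal_mult[symmetric]) (auto simp: mult_ac)
    finally have "ennreal (1 / (8 * D)) * E f \<le> ennreal (1 / (8 * D)) * ennreal (2 * D * \<sigma>)"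
      by (rule mult_left_mono) simp
    also have "\<dots> = ennreal (\<sigma> / 4)" using D \<sigma> by (subst ennreal_mult[symmetric]) auto
    also have "\<dots> \<le> L1_norm f" unfolding a \<sigma>_def by (rule L1_norm_rademacher_ge)
    finally show ?thesis using fc sub unfolding G_norm_carrier by blast
  qed
  have "function_subspace ?V"
    unfolding function_subspace_def
  proof (intro conjI ballI allI)
    show "(\<lambda>t. 0) \<in> ?V" using lin_combI[where v = ?\<rho> and k = 0] by auto
  next
    fix a x assume "x \<in> ?V"
    then obtain k where "x \<in> lin_comb ?\<rho> k" by blast
    then have "(\<lambda>t. a * x t) \<in> lin_comb ?\<rho> k" by (rule lin_comb_scale)
    then show "(\<lambda>t. a * x t) \<in> ?V" by blast
  next
    fix x y assume "x \<in> ?V"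
    then obtain k where k: "x \<in> lin_comb ?\<rho> k" by blast
    assume "y \<in> ?V"
    then obtain m where m: "y \<in> lin_comb ?\<rho> m" by blast
    have "(\<lambda>t. x t + y t) \<in> lin_comb ?\<rho> (k + m)"
      using k m lin_comb_mono[of k "k + m" ?\<rho>] lin_comb_mono[of m "k + m" ?\<rho>]
      by (intro lin_comb_add) auto
    then show "(\<lambda>t. x t + y t) \<in> ?V" by blast
  qed
  moreover have "iso_onto_image_on E L1_norm (\<lambda>x. x) ?V"
    unfolding iso_onto_image_on_def
  proof (rule exI[of _ "1 / (8 * D)"], rule exI[of _ 1], intro conjI ballI)
    fix x assume x: "x \<in> ?V"
    show "ennreal (1 / (8 * D)) * E x \<le> L1_norm x" using bnd[OF x] by blast
    show "L1_norm x \<le> ennreal 1 * E x"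
      using bnd[OF x] ri_L1_norm_le[OF E, of x] by (simp add: carrier_of_def)
  qed (use D in auto)
  moreover have "?V \<subseteq> carrier_of E" using bnd by blast
  ultimately show ?thesis
    unfolding strictly_singular_def using rademacher_span_infinite_dimensional by blast
qed

lemma embeds_if_not_strictly_singular:
  assumes E: "ri_space E" and D: "D_convex E"
    and sing: "\<not> strictly_singular E L1_norm (\<lambda>x. x)"
  shows "continuously_embeds G_norm E"
proof -
  obtain V where V: "V \<subseteq> carrier_of E" "function_subspace V" "ae_infinite_dimensional V"
    and iso: "iso_onto_image_on E L1_norm (\<lambda>x. x) V"
    using sing unfolding strictly_singular_def not_not by (elim exE conjE)
  obtain a where a: "0 < a" "\<And>v. v \<in> V \<Longrightarrow> ennreal a * E v \<le> L1_norm v"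
    using iso unfolding iso_onto_image_on_def by blast
  obtain F c where F: "\<And>\<Phi>. \<Phi> \<in> F \<Longrightarrow> orlicz_function \<Phi>" and c: "0 < c"
    and lo: "\<And>x. x \<in> carrier_of E \<Longrightarrow> ennreal (inverse c) * E x \<le> (SUP \<Phi>\<in>F. orlicz_norm \<Phi> x)"
    and up: "\<And>x. x \<in> carrier_of E \<Longrightarrow> (SUP \<Phi>\<in>F. orlicz_norm \<Phi> x) \<le> E x"
    using D unfolding D_convex_def by blast
  have VL: "V \<subseteq> carrier_of L1_norm"
    using V(1) E unfolding ri_space_def by (elim conjE) (rule order_trans)
  \<comment> \<open>On the L_1 unit ball of \<open>V\<close> the norm of E is at most
    \<open>1 / a\<close>; the factor 2 makes it strictly smaller than \<open>b\<close>, as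
    \<open>orlicz_integral_le_1\<close> demands.\<close>
  define b where "b = 2 / a"
  have b: "0 < b" using a by (simp add: b_def)
  have int: "(\<integral>\<^sup>+ t. ennreal (\<Phi> (v t / b)) \<partial>unit_leb) \<le> 1"
    if \<Phi>: "\<Phi> \<in> F" and v: "v \<in> V" "L1_norm v \<le> 1" for \<Phi> v
  proof (rule orlicz_integral_le_1[OF F[OF \<Phi>]])
    have vE: "v \<in> carrier_of E" using v(1) V(1) by blast
    then obtain r where r: "E v = ennreal r" "0 \<le> r" by (cases "E v") (auto simp: carrier_of_def)
    have "ennreal (a * r) = ennreal a * E v" unfolding r(1) using a r(2) by (intro ennreal_mult) auto
    also have "\<dots> \<le> ennreal 1" using a(2)[OF v(1)] v(2) by simp
    finally have "a * r \<le> 1" by (subst (asm) ennreal_le_iff) auto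
    then have "r < b" using a by (simp add: b_def field_simps)
    have "orlicz_norm \<Phi> v \<le> (SUP \<Phi>\<in>F. orlicz_norm \<Phi> v)" using \<Phi> by (rule SUP_upper)
    also have "\<dots> \<le> E v" by (rule up[OF vE])
    also have "\<dots> < ennreal b" unfolding r(1) using \<open>r < b\<close> b by (intro ennreal_lessI)
    finally show "orlicz_norm \<Phi> v < ennreal b" .
  qed
  show ?thesis
  proof (rule G_continuously_embeds[OF E])
    show "0 < c * (2304 * b)" using b c by simp
    fix s :: "real \<Rightarrow> real" assume s: "simple_function unit_leb s"
    have sE: "s \<in> carrier_of E" by (rule simple_function_ri_carrier[OF E s])
    have "ennreal (inverse c) * E s \<le> (SUP \<Phi>\<in>F. orlicz_norm \<Phi> s)" by (rule lo[OF sE])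
    also have "\<dots> \<le> ennreal (2304 * b) * orlicz_norm exp_square s"
    proof (rule SUP_least)
      fix \<Phi> assume \<Phi>: "\<Phi> \<in> F"
      show "orlicz_norm \<Phi> s \<le> ennreal (2304 * b) * orlicz_norm exp_square s"
        by (rule orlicz_norm_le_exp_square[OF F[OF \<Phi>] b orlicz_growth[OF F[OF \<Phi>] V(2,3) VL b int[OF \<Phi>]]
            borel_measurable_simple_function[OF s]])
    qed
    finally have "ennreal c * (ennreal (inverse c) * E s)
        \<le> ennreal c * (ennreal (2304 * b) * orlicz_norm exp_square s)" by (rule mult_left_mono) simp
    moreover have "ennreal c * (ennreal (inverse c) * E s) = E s"
    proof -
      have "ennreal c * ennreal (inverse c) = 1" using c by (subst ennreal_mult[symmetric]) auto
      then show ?thesis by (simp only: mult.assoc[symmetric] mult_1_left)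
    qed
    moreover have "ennreal c * (ennreal (2304 * b) * orlicz_norm exp_square s)
        = ennreal (c * (2304 * b)) * orlicz_norm exp_square s"
      using b c by (subst ennreal_mult) (auto simp: mult.assoc)
    ultimately show "E s \<le> ennreal (c * (2304 * b)) * orlicz_norm exp_square s" by (simp only:)
  qed
qed

theorem theorem4:
  fixes E :: ext_norm
  assumes "ri_space E" and "D_convex E"
  shows "(\<not> strictly_singular E L1_norm (\<lambda>x. x) \<longleftrightarrow> continuously_embeds G_norm E) \<and>
    (\<exists>c::real. c > 0 \<and>
      (\<forall>n\<ge>1. \<forall>x :: nat \<Rightarrow> real \<Rightarrow> real. (\<forall>i\<in>{1..n}. x i \<in> carrier_of L1_norm) \<longrightarrow>
        (\<exists>\<epsilon> :: nat \<Rightarrow> real. (\<forall>i\<in>{1..n}. \<epsilon> i \<in> {-1, 1}) \<and>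
          E (\<lambda>t. \<Sum>i=1..n. \<epsilon> i * x i t) \<ge>
            ennreal (inverse c) * E (\<lambda>t. \<Sum>i=1..n. enn2real (L1_norm (x i)) * rademacher i t))))"
  using D_convex_sign_choice[OF assms] embeds_if_not_strictly_singular[OF assms]
    not_strictly_singular_if_embeds[OF assms(1)]
  by (intro conjI iffI)

end
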